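(* Let $(\mathcal{E},\mathcal{E}_+,U,H)$ be a regular multiplicity free Hankel positive operator. Then there exist an invertible bounded operator $g \in \mathrm{GL}(\mathcal{E})$ with $g\mathcal{E}_+ = \mathcal{E}_+$ which commutes with $U$, and a unitary involution $\theta\in\mathrm{GL}(\mathcal{E})$, such that: (a) $\theta U\theta = U^*$. (b) $\theta$ is unitary for the scalar product $\langle\xi,\eta\rangle_g := \langle g\xi,g\eta\rangle$. (c) With respect to $\langle\cdot,\cdot\rangle_g$, the quadruple $(\mathcal{E},\mathcal{E}_+,\theta,U)$ is a reflection positive operator. (d) $\langle\xi,H\eta\rangle = \langle\xi,\theta\eta\rangle_g$ for all $\xi,\eta\in\mathcal{E}_+$.
   Context: Scalar products are antilinear in the first argument. A (regular multiplicity free) Hankel positive operator is a quadruple $(\mathcal{E},\mathcal{E}_+,U,H)$ corresponding to a Hankel positive representation of $(\mathbb{Z},\mathbb{N},-\mathrm{id}_{\mathbb{Z}})$, i.e.: $\mathcal{E}$ is a complex Hilbert space, $U\in\mathrm{U}(\mathcal{E})$ is a unitary operator, $\mathcal{E}_+\subseteq\mathcal{E}$ is a closed subspace with $U\mathcal{E}_+\subseteq\mathcal{E}_+$, and $H\in B(\mathcal{E}_+)$ is a positive operator satisfying $H U_+ = U_+^*H$ for the isometry $U_+ := U|_{\mathcal{E}_+}\in B(\mathcal{E}_+)$. It is regular if $\bigcap_{n\in\mathbb{Z}}U^n\mathcal{E}_+ = \{0\}$ and $\overline{\bigcup_{n\in\mathbb{Z}}U^n\mathcal{E}_+} = \mathcal{E}$.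 In the regular case, $(\mathcal{E},\mathcal{E}_+,U)$ is unitarily equivalent to $(\ell^2(\mathbb{Z},\mathcal{K}),\ell^2(\mathbb{N}_0,\mathcal{K}),S)$ with $S$ the right shift and $\mathcal{K} := \mathcal{E}_+\cap(U\mathcal{E}_+)^\perp$ (Wold decomposition); it is multiplicity free if $\mathcal{K}\cong\mathbb{C}$, i.e. if it is equivalent to $(L^2(\mathbb{T}),H^2(\mathbb{D}),U)$ with $(Uf)(z) = zf(z)$. A reflection positive operator is a quadruple $(\mathcal{E},\mathcal{E}_+,\theta,U)$, where $\mathcal{E}$ is a Hilbert space, $\theta$ is a unitary involution on $\mathcal{E}$, $\mathcal{E}_+\subseteq\mathcal{E}$ is a closed subspace with $\langle\xi,\theta\xi\rangle\geq 0$ for all $\xi\in\mathcal{E}_+$, and $U$ is a unitary operator on $\mathcal{E}$ with $U\mathcal{E}_+\subseteq\mathcal{E}_+$ and $\theta U\theta = U^*$. *)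

theory Defs
  imports "HOL-Analysis.Analysis"
begin

text \<open>
  The Hilbert space is a whole type \<open>'a\<close>; its complex scalar multiplication
  and its scalar product are explicit parameters, because the theorem
  considers two scalar products on the same vector space.  All topological notions are
  those of the metric determined by the scalar product.  Scalar products are antilinear in the
  first argument.
\<close>

definition hnorm :: "('a \<Rightarrow> 'a \<Rightarrow> complex) \<Rightarrow> 'a \<Rightarrow> real" where
  "hnorm ip x = sqrt (Re (ip x x))"

definition hdist :: "('a::ab_group_add \<Rightarrow> 'a \<Rightarrow> complex) \<Rightarrow> 'a \<Rightarrow> 'a \<Rightarrow> real" where
  "hdist ip x y = hnorm ip (x - y)"

abbreviation htopology :: "('a::ab_group_add \<Rightarrow> 'a \<Rightarrow> complex) \<Rightarrow> 'a topology" where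
  "htopology ip \<equiv> Metric_space.mtopology UNIV (hdist ip)"

locale complex_hilbert_space = vector_space scaleC
  for scaleC :: "complex \<Rightarrow> 'a::ab_group_add \<Rightarrow> 'a" +
  fixes ip :: "'a \<Rightarrow> 'a \<Rightarrow> complex"
  assumes ip_add_right: "ip x (y + z) = ip x y + ip x z"
    and ip_scale_right: "ip x (scaleC c y) = c * ip x y"
    and ip_commute: "ip y x = cnj (ip x y)"
    and ip_nonneg: "ip x x \<in> \<real>\<^sub>\<ge>\<^sub>0"
    and ip_definite: "ip x x = 0 \<Longrightarrow> x = 0"
    and complete: "Metric_space.mcomplete UNIV (hdist ip)"

definition closed_subspace ::
  "(complex \<Rightarrow> 'a::ab_group_add \<Rightarrow> 'a) \<Rightarrow> ('a \<Rightarrow> 'a \<Rightarrow> complex) \<Rightarrow> 'a set \<Rightarrow> bool" where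
  "closed_subspace scaleC ip V \<longleftrightarrow> module.subspace scaleC V \<and> closedin (htopology ip) V"

definition orth_compl :: "('a \<Rightarrow> 'a \<Rightarrow> complex) \<Rightarrow> 'a set \<Rightarrow> 'a set" where
  "orth_compl ip V = {x. \<forall>y\<in>V. ip y x = 0}"

text \<open>An element of \<open>B(V)\<close> is a total function of which only the values on \<open>V\<close> matter.\<close>

definition bounded_operator_on ::
  "(complex \<Rightarrow> 'a::ab_group_add \<Rightarrow> 'a) \<Rightarrow> ('a \<Rightarrow> 'a \<Rightarrow> complex) \<Rightarrow> 'a set \<Rightarrow> ('a \<Rightarrow> 'a) \<Rightarrow> bool" where
  "bounded_operator_on scaleC ip V A \<longleftrightarrow>
     A ` V \<subseteq> V \<and>
     (\<forall>x\<in>V. \<forall>y\<in>V. A (x + y) = A x + A y) \<and>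
     (\<forall>c. \<forall>x\<in>V. A (scaleC c x) = scaleC c (A x)) \<and>
     (\<exists>C. \<forall>x\<in>V. hnorm ip (A x) \<le> C * hnorm ip x)"

text \<open>
  The adjoint of \<open>A \<in> B(V)\<close>, for a closed subspace \<open>V\<close>.  For \<open>y \<in> V\<close> the vector \<open>z\<close> exists and
  is unique by the Riesz representation theorem in the Hilbert space \<open>V\<close>.
\<close>

definition adjoint_on :: "('a \<Rightarrow> 'a \<Rightarrow> complex) \<Rightarrow> 'a set \<Rightarrow> ('a \<Rightarrow> 'a) \<Rightarrow> 'a \<Rightarrow> 'a" where
  "adjoint_on ip V A y = (THE z. z \<in> V \<and> (\<forall>x\<in>V. ip (A x) y = ip x z))"

definition positive_operator_on ::
  "(complex \<Rightarrow> 'a::ab_group_add \<Rightarrow> 'a) \<Rightarrow> ('a \<Rightarrow> 'a \<Rightarrow> complex) \<Rightarrow> 'a set \<Rightarrow> ('a \<Rightarrow> 'a) \<Rightarrow> bool" where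
  "positive_operator_on scaleC ip V A \<longleftrightarrow>
     bounded_operator_on scaleC ip V A \<and> (\<forall>x\<in>V. ip x (A x) \<in> \<real>\<^sub>\<ge>\<^sub>0)"

definition GL ::
  "(complex \<Rightarrow> 'a::ab_group_add \<Rightarrow> 'a) \<Rightarrow> ('a \<Rightarrow> 'a \<Rightarrow> complex) \<Rightarrow> ('a \<Rightarrow> 'a) set" where
  "GL scaleC ip = {g. bounded_operator_on scaleC ip UNIV g \<and> bij g \<and>
                     bounded_operator_on scaleC ip UNIV (inv g)}"

definition unitary_operator ::
  "(complex \<Rightarrow> 'a::ab_group_add \<Rightarrow> 'a) \<Rightarrow> ('a \<Rightarrow> 'a \<Rightarrow> complex) \<Rightarrow> ('a \<Rightarrow> 'a) \<Rightarrow> bool" where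
  "unitary_operator scaleC ip W \<longleftrightarrow>
     Vector_Spaces.linear scaleC scaleC W \<and> surj W \<and> (\<forall>x y. ip (W x) (W y) = ip x y)"

definition int_funpow :: "('a \<Rightarrow> 'a) \<Rightarrow> int \<Rightarrow> 'a \<Rightarrow> 'a" where
  "int_funpow W n = (if 0 \<le> n then W ^^ nat n else inv W ^^ nat (- n))"

locale hankel_positive_operator = complex_hilbert_space scaleC ip
  for scaleC :: "complex \<Rightarrow> 'a::ab_group_add \<Rightarrow> 'a" and ip :: "'a \<Rightarrow> 'a \<Rightarrow> complex" +
  fixes Ep :: "'a set" and U H :: "'a \<Rightarrow> 'a"
  assumes U_unitary: "unitary_operator scaleC ip U"
    and Ep_closed_subspace: "closed_subspace scaleC ip Ep"
    and U_Ep: "U ` Ep \<subseteq> Ep"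
    and H_positive: "positive_operator_on scaleC ip Ep H"
    and H_hankel: "\<And>\<xi>. \<xi> \<in> Ep \<Longrightarrow> H (U \<xi>) = adjoint_on ip Ep U (H \<xi>)"

definition wandering_subspace ::
  "('a \<Rightarrow> 'a \<Rightarrow> complex) \<Rightarrow> 'a set \<Rightarrow> ('a \<Rightarrow> 'a) \<Rightarrow> 'a set" where
  "wandering_subspace ip Ep U = Ep \<inter> orth_compl ip (U ` Ep)"

text \<open>Multiplicity freeness asks for a unitary isomorphism of the wandering subspace onto \<open>\<complex>\<close>.\<close>

locale regular_multiplicity_free_hankel_positive_operator = hankel_positive_operator +
  assumes regular_Inter: "(\<Inter>n::int. int_funpow U n ` Ep) = {0}"
    and regular_Union: "htopology ip closure_of (\<Union>n::int. int_funpow U n ` Ep) = UNIV"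
    and multiplicity_free:
      "\<exists>\<phi>::'a \<Rightarrow> complex. bij_betw \<phi> (wandering_subspace ip Ep U) UNIV \<and>
         (\<forall>x\<in>wandering_subspace ip Ep U. \<forall>y\<in>wandering_subspace ip Ep U.
            \<phi> (x + y) = \<phi> x + \<phi> y \<and> ip x y = cnj (\<phi> x) * \<phi> y) \<and>
         (\<forall>c. \<forall>x\<in>wandering_subspace ip Ep U. \<phi> (scaleC c x) = c * \<phi> x)"

locale reflection_positive_operator = complex_hilbert_space scaleC ip
  for scaleC :: "complex \<Rightarrow> 'a::ab_group_add \<Rightarrow> 'a" and ip :: "'a \<Rightarrow> 'a \<Rightarrow> complex" +
  fixes Ep :: "'a set" and \<theta> U :: "'a \<Rightarrow> 'a"
  assumes \<theta>_unitary: "unitary_operator scaleC ip \<theta>"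
    and \<theta>_involution: "\<theta> \<circ> \<theta> = id"
    and Ep_closed_subspace: "closed_subspace scaleC ip Ep"
    and \<theta>_positive: "\<And>\<xi>. \<xi> \<in> Ep \<Longrightarrow> ip \<xi> (\<theta> \<xi>) \<in> \<real>\<^sub>\<ge>\<^sub>0"
    and U_unitary: "unitary_operator scaleC ip U"
    and U_Ep: "U ` Ep \<subseteq> Ep"
    and \<theta>_U_\<theta>: "\<theta> \<circ> U \<circ> \<theta> = adjoint_on ip UNIV U"

definition ip_twist :: "('a \<Rightarrow> 'a \<Rightarrow> complex) \<Rightarrow> ('a \<Rightarrow> 'a) \<Rightarrow> 'a \<Rightarrow> 'a \<Rightarrow> complex" where
  "ip_twist ip g \<xi> \<eta> = ip (g \<xi>) (g \<eta>)"

end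

theory Submission
  imports Defs
begin

text \<open>
  On \<open>H\<^sup>2\<close> the operator \<open>H\<close> has a Hankel matrix \<open>(a\<^sub>j\<^sub>+\<^sub>k)\<close>, and the task is to find a bounded symbol
  with the nonnegative coefficients \<open>a\<^sub>n\<close>.  The freedom in the choice of the symbol is large enough
  to make its modulus a constant \<open>M > \<parallel>H\<parallel>\<close>; then \<open>g = \<surd>M\<close> is a scalar and \<open>\<theta>\<close> is \<open>1/M\<close> times the Hankel
  operator of the symbol on the whole space \<open>\<E>\<close>.

  The coefficient \<open>a\<^sub>-\<^sub>1\<close> is chosen maximal subject to the bound \<open>M\<close>, so that \<open>M\<close> becomes an
  eigenvalue of the Hankel matrix \<open>(a\<^sub>j\<^sub>+\<^sub>k\<^sub>-\<^sub>1)\<close>, with eigenvector \<open>f \<in> \<E>\<^sub>+\<close> say.  The remaining \<open>a\<^sub>-\<^sub>n\<close> are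
  found one at a time without increasing the norm (Parrott's argument, for self-adjoint forms),
  which yields a self-adjoint operator \<open>A\<close> on \<open>\<E>\<close> with the matrix \<open>(a\<^sub>j\<^sub>+\<^sub>k\<^sub>-\<^sub>1)\<close> over \<open>\<int>\<close>, with \<open>\<parallel>A\<parallel> \<le> M\<close>, and
  therefore with \<open>A f = M f\<close>.  Since \<open>A\<^sup>2\<close> commutes with \<open>U\<close> and \<open>A\<^sup>2 f = M\<^sup>2 f\<close> for a nonzero \<open>f \<in> \<E>\<^sub>+\<close>,
  it follows that \<open>A\<^sup>2 = M\<^sup>2\<close>, and \<open>\<theta> = A U / M\<close>.
\<close>

section \<open>Hilbert spaces with an explicit scalar product\<close>

text \<open>First variation at a minimum: a real quadratic that vanishes at 0 and is nowhere
  negative has no linear term. It serves the minimization in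
  \<open>Riesz_on_subspace\<close>.\<close>

lemma linear_coeff_eq_0:
  fixes c d :: real
  assumes "\<And>t. 0 \<le> 2 * t * d + t\<^sup>2 * c" and "0 \<le> c"
  shows "d = 0"
proof -
  \<comment> \<open>Dividing by \<open>c + 1\<close> instead of \<open>c\<close> also covers
    \<open>c = 0\<close>; the quadratic takes the value \<open>- t^2 (c + 2)\<close> here.\<close>
  define t where "t = - d / (c + 1)"
  have d: "d = - t * (c + 1)" using \<open>0 \<le> c\<close> by (simp add: t_def)
  have "0 \<le> - (t\<^sup>2 * (c + 2))"
    using assms(1)[of t] unfolding d by (simp add: power2_eq_square algebra_simps)
  moreover have "0 \<le> t\<^sup>2 * (c + 2)" using \<open>0 \<le> c\<close> by simp
  ultimately have "t\<^sup>2 * (c + 2) = 0" by linarith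
  then have "t = 0" using \<open>0 \<le> c\<close> by simp
  then show ?thesis by (simp add: d)
qed

context complex_hilbert_space
begin

section \<open>Algebra of the scalar product and its norm\<close>

abbreviation nm :: "'a \<Rightarrow> real" where "nm \<equiv> hnorm ip"

lemma ip_add_left: "ip (x + y) z = ip x z + ip y z"
  by (metis ip_add_right ip_commute complex_cnj_add)

lemma ip_scale_left: "ip (scaleC c x) y = cnj c * ip x y"
  by (metis ip_scale_right ip_commute complex_cnj_mult)

lemma ip_zero_right [simp]: "ip x 0 = 0"
  using ip_add_right[of x 0 0] by simp

lemma ip_zero_left [simp]: "ip 0 x = 0"
  using ip_add_left[of 0 0 x] by simp

lemma ip_minus_right: "ip x (- y) = - ip x y"
  using ip_add_right[of x y "- y"] by (simp add: add_eq_0_iff)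

lemma ip_minus_left: "ip (- x) y = - ip x y"
  using ip_add_left[of x "- x" y] by (simp add: add_eq_0_iff)

lemma ip_diff_right: "ip x (y - z) = ip x y - ip x z"
  using ip_add_right[of x y "- z"] by (simp add: ip_minus_right)

lemma ip_diff_left: "ip (x - y) z = ip x z - ip y z"
  using ip_add_left[of x "- y" z] by (simp add: ip_minus_left)

lemmas ip_simps = ip_add_left ip_add_right ip_diff_left ip_diff_right ip_scale_left ip_scale_right

lemma ip_self_Re: "0 \<le> Re (ip x x)" and ip_self_Im: "Im (ip x x) = 0"
  using ip_nonneg[of x] by (auto simp: complex_nonneg_Reals_iff)

lemma nm_nonneg [simp]: "0 \<le> nm x"
  by (simp add: hnorm_def ip_self_Re)

lemma nm_sq: "(nm x)\<^sup>2 = Re (ip x x)"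
  by (simp add: hnorm_def ip_self_Re)

lemma ip_self: "ip x x = of_real ((nm x)\<^sup>2)"
  by (simp add: complex_eq_iff nm_sq ip_self_Im)

lemma nm_eq_0 [simp]: "nm x = 0 \<longleftrightarrow> x = 0"
proof
  assume "nm x = 0"
  then have "ip x x = 0" by (simp add: ip_self)
  then show "x = 0" by (rule ip_definite)
qed (simp add: hnorm_def)

lemma nm_zero [simp]: "nm 0 = 0"
  by simp

lemma nm_pos: "x \<noteq> 0 \<Longrightarrow> 0 < nm x"
  by (simp add: less_le)

lemma nm_scale: "nm (scaleC c x) = cmod c * nm x"
proof -
  have "(nm (scaleC c x))\<^sup>2 = (cmod c * nm x)\<^sup>2"
    unfolding power_mult_distrib by (simp add: nm_sq ip_simps ip_self_Im cmod_power2)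
      (simp add: power2_eq_square algebra_simps)
  then show ?thesis by simp
qed

lemma nm_minus [simp]: "nm (- x) = nm x"
  using nm_scale[of "- 1" x] by (simp add: scale_minus_left)

lemma nm_minus_commute: "nm (x - y) = nm (y - x)"
  by (metis nm_minus minus_diff_eq)

lemma nm_add_sq: "(nm (x + y))\<^sup>2 = (nm x)\<^sup>2 + (nm y)\<^sup>2 + 2 * Re (ip x y)"
  using arg_cong[OF ip_commute[of x y], of Re] unfolding nm_sq by (simp add: ip_simps)

lemma nm_diff_sq: "(nm (x - y))\<^sup>2 = (nm x)\<^sup>2 + (nm y)\<^sup>2 - 2 * Re (ip x y)"
  using arg_cong[OF ip_commute[of x y], of Re] unfolding nm_sq by (simp add: ip_simps)

lemma Cauchy_Schwarz: "cmod (ip x y) \<le> nm x * nm y"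
proof (cases "x = 0")
  case False
  then have pos: "0 < (nm x)\<^sup>2" by (simp add: zero_less_power2)
  define c where "c = ip x y / of_real ((nm x)\<^sup>2)"
  have "0 \<le> (nm (y - scaleC c x))\<^sup>2" by simp
  also have "\<dots> = (nm y)\<^sup>2 + (cmod c)\<^sup>2 * (nm x)\<^sup>2 - 2 * Re (cnj (c * cnj (ip x y)))"
    unfolding nm_diff_sq nm_scale power_mult_distrib
    by (simp add: ip_simps ip_commute[of x y] mult.commute)
  also have "\<dots> = (nm y)\<^sup>2 - (cmod (ip x y))\<^sup>2 / (nm x)\<^sup>2"
  proof -
    have "c * cnj (ip x y) = of_real ((cmod (ip x y))\<^sup>2 / (nm x)\<^sup>2)"
      unfolding c_def using complex_norm_square[of "ip x y"] by simp
    moreover have "(cmod c)\<^sup>2 * (nm x)\<^sup>2 = (cmod (ip x y))\<^sup>2 / (nm x)\<^sup>2"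
      using pos unfolding c_def
      by (simp add: norm_divide norm_mult power2_eq_square)
    ultimately show ?thesis by simp
  qed
  finally have "(cmod (ip x y))\<^sup>2 \<le> (nm x * nm y)\<^sup>2"
    using pos by (simp add: divide_le_eq power_mult_distrib mult.commute)
  then show ?thesis by (rule power2_le_imp_le) simp
qed simp

lemma Re_ip_le: "\<bar>Re (ip x y)\<bar> \<le> nm x * nm y"
  using abs_Re_le_cmod Cauchy_Schwarz order_trans by blast

lemma nm_triangle: "nm (x + y) \<le> nm x + nm y"
proof (rule power2_le_imp_le)
  show "(nm (x + y))\<^sup>2 \<le> (nm x + nm y)\<^sup>2"
    using Re_ip_le[of x y] unfolding nm_add_sq by (simp add: power2_sum)
qed simp

lemma nm_triangle_sub: "nm (x - z) \<le> nm (x - y) + nm (y - z)"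
  using nm_triangle[of "x - y" "y - z"] by simp

lemma nm_reverse_triangle: "\<bar>nm x - nm y\<bar> \<le> nm (x - y)"
  using nm_triangle[of "x - y" y] nm_triangle[of "y - x" x] nm_minus_commute[of x y] by simp

lemma Re_ip_commute: "Re (ip x y) = Re (ip y x)"
  using arg_cong[OF ip_commute[of x y], of Re] by simp

section \<open>Convergence and density in the norm metric\<close>

sublocale hmetric: Metric_space UNIV "hdist ip"
  by unfold_locales
    (auto simp: hdist_def nm_minus_commute nm_triangle_sub)

definition converges :: "(nat \<Rightarrow> 'a) \<Rightarrow> 'a \<Rightarrow> bool" where
  "converges s z \<longleftrightarrow> (\<lambda>n. nm (s n - z)) \<longlonglongrightarrow> 0"

lemma limitin_iff_converges: "limitin (htopology ip) s z sequentially \<longleftrightarrow> converges s z"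
  by (simp add: converges_def hmetric.limit_metric_sequentially hdist_def LIMSEQ_def)

lemma Cauchy_converges:
  assumes "\<And>\<epsilon>. \<epsilon> > 0 \<Longrightarrow> \<exists>N. \<forall>n\<ge>N. \<forall>m\<ge>N. nm (s n - s m) < \<epsilon>"
  obtains z where "converges s z"
proof -
  have "hmetric.MCauchy s"
    using assms by (fastforce simp: hmetric.MCauchy_def hdist_def)
  then show ?thesis
    using complete that by (auto simp: hmetric.mcomplete_def limitin_iff_converges)
qed

lemma closed_subspace_iff:
  "closed_subspace scaleC ip V \<longleftrightarrow>
     subspace V \<and> (\<forall>s z. range s \<subseteq> V \<longrightarrow> converges s z \<longrightarrow> z \<in> V)"
  by (auto simp: closed_subspace_def hmetric.metric_closedin_iff_sequentially_closed
      limitin_iff_converges)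

lemma converges_const: "converges (\<lambda>_. z) z"
  by (simp add: converges_def hnorm_def)

lemma converges_isometric:
  assumes "converges s z" and "\<And>n. nm (t n - w) \<le> C * nm (s n - z)"
  shows "converges t w"
proof -
  have "(\<lambda>n. C * nm (s n - z)) \<longlonglongrightarrow> 0"
    using assms(1) tendsto_mult_right_zero unfolding converges_def by blast
  then show ?thesis
    unfolding converges_def by (rule Lim_null_comparison[rotated]) (simp add: assms(2))
qed

lemma converges_unique:
  assumes "converges s z" "converges s w"
  shows "z = w"
proof -
  have "nm (z - w) \<le> nm (s n - z) + nm (s n - w)" for n
    using nm_triangle_sub[of z w "s n"] nm_minus_commute by metis
  moreover have "(\<lambda>n. nm (s n - z) + nm (s n - w)) \<longlonglongrightarrow> 0"
    using assms tendsto_add_zero unfolding converges_def by blast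
  ultimately have "nm (z - w) \<le> 0"
    by (meson LIMSEQ_le_const)
  then show ?thesis by (metis nm_nonneg order_antisym nm_eq_0 right_minus_eq)
qed

lemma converges_ip:
  assumes "converges s z"
  shows "(\<lambda>n. ip v (s n)) \<longlonglongrightarrow> ip v z"
proof -
  have "(\<lambda>n. nm v * nm (s n - z)) \<longlonglongrightarrow> 0"
    using assms tendsto_mult_right_zero unfolding converges_def by blast
  then have "(\<lambda>n. ip v (s n) - ip v z) \<longlonglongrightarrow> 0"
    by (rule Lim_null_comparison[rotated]) (simp add: Cauchy_Schwarz flip: ip_diff_right)
  then show ?thesis by (simp add: LIM_zero_iff)
qed

lemma dense_converges:
  assumes "htopology ip closure_of S = UNIV"
  obtains s where "range s \<subseteq> S" "converges s z"
proof -
  have "\<forall>r>0. \<exists>y\<in>S. nm (z - y) < r"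
    using assms by (auto simp: hmetric.metric_closure_of hdist_def set_eq_iff)
  then have "\<forall>n. \<exists>y. y \<in> S \<and> nm (z - y) < inverse (real (Suc n))"
    by (metis inverse_positive_iff_positive of_nat_0_less_iff zero_less_Suc)
  then obtain s where s: "\<And>n. s n \<in> S" "\<And>n. nm (z - s n) < inverse (real (Suc n))"
    by metis
  have "(\<lambda>n. nm (s n - z)) \<longlonglongrightarrow> 0"
    by (rule Lim_null_comparison[OF _ LIMSEQ_inverse_real_of_nat])
      (use s(2) in \<open>auto simp: nm_minus_commute less_imp_le\<close>)
  then show ?thesis using that s(1) by (auto simp: converges_def)
qed

lemma dense_ip_eq:
  assumes "htopology ip closure_of D = UNIV" and "\<And>x. x \<in> D \<Longrightarrow> ip z x = ip w x"
  shows "z = w"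
proof -
  obtain s where s: "range s \<subseteq> D" "converges s (z - w)"
    using dense_converges[OF assms(1)] by metis
  have "ip (z - w) (s n) = 0" for n
    using s(1) assms(2) by (auto simp: ip_diff_left)
  then have "ip (z - w) (z - w) = 0"
    using converges_ip[OF s(2), of "z - w"] by (simp add: LIMSEQ_const_iff)
  then show ?thesis using ip_definite by force
qed

text \<open>
  The subspace need not be closed; the representing vector is the limit of a minimizing sequence
  of \<open>\<parallel>y\<parallel>\<^sup>2 - 2 Re (\<phi> y)\<close>.
\<close>

lemma Riesz_on_subspace:
  assumes D: "subspace D"
    and add: "\<And>x y. x \<in> D \<Longrightarrow> y \<in> D \<Longrightarrow> \<phi> (x + y) = \<phi> x + \<phi> y"
    and scale: "\<And>c x. x \<in> D \<Longrightarrow> \<phi> (scaleC c x) = c * \<phi> x"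
    and bound: "\<And>x. x \<in> D \<Longrightarrow> cmod (\<phi> x) \<le> K * nm x" and "0 \<le> K"
  obtains s z where "range s \<subseteq> D" "converges s z" "nm z \<le> K" "\<And>x. x \<in> D \<Longrightarrow> \<phi> x = ip z x"
proof -
  define J where "J y = (nm y)\<^sup>2 - 2 * Re (\<phi> y)" for y
  define I where "I = (INF y\<in>D. J y)"
  \<comment> \<open>Completing the square: \<open>J y\<close> is at least
    \<open>(nm y - K)^2 - K^2\<close>.\<close>
  have "- K\<^sup>2 \<le> J y" if "y \<in> D" for y
  proof -
    have "Re (\<phi> y) \<le> K * nm y"
      using bound[OF that] complex_Re_le_cmod order_trans by blast
    moreover have "0 \<le> (nm y - K)\<^sup>2" by simp
    ultimately show ?thesis by (simp add: J_def power2_diff mult.commute)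
  qed
  then have bdd: "bdd_below (J ` D)" by (meson bdd_belowI2)
  have I_le: "I \<le> J y" if "y \<in> D" for y
    unfolding I_def using bdd that by (rule cINF_lower)
  have "\<exists>y. y \<in> D \<and> J y < I + inverse (real (Suc n))" for n
  proof -
    have "I < I + inverse (real (Suc n))" by simp
    moreover have "D \<noteq> {}" using D subspace_0 by auto
    ultimately show ?thesis
      unfolding I_def using cINF_less_iff[OF _ bdd] by blast
  qed
  then obtain s where s: "\<And>n. s n \<in> D" "\<And>n. J (s n) < I + inverse (real (Suc n))"
    by metis
  \<comment> \<open>The parallelogram law turns near-minimality of two terms into closeness, because
    their midpoint cannot push \<open>J\<close> below \<open>I\<close>.\<close>
  have par: "(nm (s n - s m))\<^sup>2 \<le> 2 * inverse (real (Suc n)) + 2 * inverse (real (Suc m))" for n m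
  proof -
    define mid where "mid = scaleC (1/2) (s n + s m)"
    have mem: "s n + s m \<in> D" "mid \<in> D"
      using D s(1) by (auto simp: mid_def subspace_add subspace_scale)
    have "(nm mid)\<^sup>2 = (nm (s n + s m))\<^sup>2 / 4"
      unfolding mid_def nm_scale by (simp add: power_divide)
    moreover have "Re (\<phi> mid) = (Re (\<phi> (s n)) + Re (\<phi> (s m))) / 2"
      unfolding mid_def using mem(1) s(1) by (simp add: scale add)
    ultimately have "(nm (s n - s m))\<^sup>2 = 2 * J (s n) + 2 * J (s m) - 4 * J mid"
      unfolding J_def nm_diff_sq nm_add_sq by (simp add: field_simps)
    then show ?thesis using s(2)[of n] s(2)[of m] I_le[OF mem(2)] by linarith
  qed
  have inv0: "(\<lambda>n. inverse (real (Suc n))) \<longlonglongrightarrow> 0" by (rule LIMSEQ_inverse_real_of_nat)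
  obtain z where z: "converges s z"
  proof (rule Cauchy_converges)
    fix \<epsilon> :: real assume "\<epsilon> > 0"
    then have "eventually (\<lambda>n. inverse (real (Suc n)) < \<epsilon>\<^sup>2 / 4) sequentially"
      by (intro order_tendstoD(2)[OF inv0]) simp
    then obtain N where N: "\<And>n. n \<ge> N \<Longrightarrow> inverse (real (Suc n)) < \<epsilon>\<^sup>2 / 4"
      by (auto simp: eventually_sequentially)
    have "nm (s n - s m) < \<epsilon>" if "n \<ge> N" "m \<ge> N" for n m
    proof (rule power2_less_imp_less)
      show "(nm (s n - s m))\<^sup>2 < \<epsilon>\<^sup>2"
        using par[of n m] N[OF that(1)] N[OF that(2)] by linarith
      show "0 \<le> \<epsilon>" using \<open>\<epsilon> > 0\<close> by simp
    qed
    then show "\<exists>N. \<forall>n\<ge>N. \<forall>m\<ge>N. nm (s n - s m) < \<epsilon>" by blast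
  qed (rule that)
  have Re_eq: "Re (\<phi> v) = Re (ip z v)" if v: "v \<in> D" for v
  proof -
    define d where "d = Re (ip z v) - Re (\<phi> v)"
    have lim_v: "(\<lambda>n. Re (ip (s n) v)) \<longlonglongrightarrow> Re (ip z v)"
      using tendsto_Re[OF converges_ip[OF z, of v]] unfolding Re_ip_commute[of v] .
    \<comment> \<open>Moving from \<open>s n\<close> to \<open>s n + t v\<close> lowers
      \<open>J\<close> by less than the minimization defect \<open>1 / (n + 1)\<close>; the defect
      disappears in the limit.\<close>
    have quad: "0 \<le> 2 * t * d + t\<^sup>2 * (nm v)\<^sup>2" for t
    proof -
      let ?v = "scaleC (of_real t) v"
      have "0 \<le> inverse (real (Suc n)) + 2 * t * (Re (ip (s n) v) - Re (\<phi> v)) + t\<^sup>2 * (nm v)\<^sup>2" for n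
      proof -
        have "?v \<in> D" "s n + ?v \<in> D"
          using D s(1) v by (auto simp: subspace_add subspace_scale)
        then have "I \<le> J (s n + ?v)" by (intro I_le)
        also have "\<dots> = J (s n) + 2 * t * (Re (ip (s n) v) - Re (\<phi> v)) + t\<^sup>2 * (nm v)\<^sup>2"
          unfolding J_def nm_add_sq using \<open>?v \<in> D\<close> s(1) v
          by (simp add: add scale nm_scale power_mult_distrib ip_simps algebra_simps)
        finally show ?thesis using s(2)[of n] by linarith
      qed
      moreover have "(\<lambda>n. inverse (real (Suc n)) + 2 * t * (Re (ip (s n) v) - Re (\<phi> v)) + t\<^sup>2 * (nm v)\<^sup>2)
          \<longlonglongrightarrow> 0 + 2 * t * d + t\<^sup>2 * (nm v)\<^sup>2"
        unfolding d_def by (intro tendsto_intros lim_v inv0)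
      ultimately show ?thesis using LIMSEQ_le_const[of _ _ 0] by (metis (no_types, lifting) add_0)
    qed
    have "d = 0" by (rule linear_coeff_eq_0[OF quad]) simp
    then show ?thesis by (simp add: d_def)
  qed
  have eq: "\<phi> v = ip z v" if v: "v \<in> D" for v
  proof -
    have "scaleC \<i> v \<in> D" using D v by (simp add: subspace_scale)
    from Re_eq[OF this] Re_eq[OF v] show ?thesis
      using v by (simp add: scale ip_simps complex_eq_iff)
  qed
  \<comment> \<open>\<open>z\<close> may lie outside \<open>D\<close>, where nothing is known about
    \<open>\<phi>\<close>; the bound by \<open>K\<close> is applied along \<open>s\<close> and
    passed to the limit.\<close>
  have "(\<lambda>n. cmod (ip z (s n))) \<longlonglongrightarrow> cmod (ip z z)"
    by (intro tendsto_norm converges_ip z)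
  moreover have "(\<lambda>n. K * nm (s n)) \<longlonglongrightarrow> K * nm z"
  proof -
    have "(\<lambda>n. nm (s n)) \<longlonglongrightarrow> nm z"
    proof (rule LIM_zero_cancel, rule Lim_null_comparison)
      show "\<forall>\<^sub>F n in sequentially. norm (nm (s n) - nm z) \<le> nm (s n - z)"
        by (simp add: nm_reverse_triangle)
    qed (use z in \<open>simp add: converges_def\<close>)
    then show ?thesis by (rule tendsto_mult_left)
  qed
  moreover have "cmod (ip z (s n)) \<le> K * nm (s n)" for n
    using bound[OF s(1)] eq[OF s(1)] by metis
  ultimately have "(nm z)\<^sup>2 \<le> K * nm z"
    using LIMSEQ_le[of "\<lambda>n. cmod (ip z (s n))" "cmod (ip z z)" "\<lambda>n. K * nm (s n)" "K * nm z"]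
    by (simp add: ip_self norm_mult power2_eq_square)
  then have "nm z \<le> K"
    using \<open>0 \<le> K\<close> nm_pos[of z] by (cases "z = 0") (auto simp: power2_eq_square)
  with that s(1) z eq show ?thesis by blast
qed

lemma converges_operator:
  assumes "converges s z" and "\<And>x y. A (x + y) = A x + A y" and "\<And>x. nm (A x) \<le> C * nm x"
  shows "converges (\<lambda>n. A (s n)) (A z)"
proof (rule converges_isometric[OF assms(1)])
  show "nm (A (s n) - A z) \<le> C * nm (s n - z)" for n
    using assms(3)[of "s n - z"] assms(2)[of "s n - z" z] by simp
qed

section \<open>Orthogonal expansions and their remainders\<close>

primrec residual :: "(nat \<Rightarrow> 'a) \<Rightarrow> 'a \<Rightarrow> nat \<Rightarrow> 'a" where
  "residual u x 0 = x"
| "residual u x (Suc n) = residual u x n - scaleC (ip (u n) x / ip (u n) (u n)) (u n)"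

text \<open>An operator that kills every \<open>u k\<close> does not notice the subtracted
  components. If it is bounded and the residuals tend to 0, it therefore kills \<open>x\<close> as
  well.\<close>

lemma operator_residual:
  assumes "\<And>y z. L (y + z) = L y + L z" "\<And>c y. L (scaleC c y) = scaleC c (L y)" "\<And>k. L (u k) = 0"
  shows "L (residual u x n) = L x"
proof (induction n)
  case (Suc n)
  have "L (residual u x n) = L (residual u x (Suc n) + scaleC (ip (u n) x / ip (u n) (u n)) (u n))"
    by simp
  then show ?case unfolding assms using Suc by simp
qed simp

context
  fixes u :: "nat \<Rightarrow> 'a" and x :: 'a
  assumes orth: "\<And>m n. m \<noteq> n \<Longrightarrow> ip (u m) (u n) = 0"
begin

lemma ip_residual: "ip (u k) (residual u x n) = (if k < n then 0 else ip (u k) x)"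
proof (induction n)
  case (Suc n)
  then show ?case
    using orth[of k n] ip_definite[of "u n"] by (auto simp: ip_simps less_Suc_eq)
qed simp

lemma residual_diff_orth: "m \<le> n \<Longrightarrow> ip (residual u x m - residual u x n) (residual u x k) = 0"
  if "n \<le> k"
  using that
proof (induction n)
  case (Suc n)
  show ?case
  proof (cases "m = Suc n")
    case False
    then have "ip (residual u x m - residual u x n) (residual u x k) = 0"
      using Suc by simp
    moreover have "ip (u n) (residual u x k) = 0"
      using Suc.prems by (simp add: ip_residual)
    ultimately show ?thesis by (simp add: ip_simps)
  qed simp
qed simp

lemma residual_diff_sq:
  assumes "m \<le> n"
  shows "(nm (residual u x m - residual u x n))\<^sup>2 = (nm (residual u x m))\<^sup>2 - (nm (residual u x n))\<^sup>2"
  using nm_add_sq[of "residual u x m - residual u x n" "residual u x n"]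
    residual_diff_orth[OF order_refl assms] by simp

text \<open>The squared norms of the residuals decrease, hence form a Cauchy sequence, and by
  Pythagoras they control the distances. The limit is 0 only for a suitable family.\<close>

lemma residual_converges: obtains r where "converges (residual u x) r"
proof (rule Cauchy_converges)
  fix \<epsilon> :: real assume "\<epsilon> > 0"
  let ?a = "\<lambda>n. (nm (residual u x n))\<^sup>2"
  have dec: "?a n \<le> ?a m" if "m \<le> n" for m n
    using residual_diff_sq[OF that] by (metis diff_ge_0_iff_ge zero_le_power2)
  then have "decseq ?a" unfolding decseq_def by blast
  then have "convergent ?a"
    by (metis decseq_convergent convergentI zero_le_power2)
  then have "Cauchy ?a" by (rule convergent_Cauchy)
  then obtain N where N: "\<And>m n. m \<ge> N \<Longrightarrow> n \<ge> N \<Longrightarrow> \<bar>?a m - ?a n\<bar> < \<epsilon>\<^sup>2"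
    using \<open>\<epsilon> > 0\<close> unfolding Cauchy_def dist_real_def by (metis zero_less_power)
  have "nm (residual u x m - residual u x n) < \<epsilon>" if "N \<le> m" "m \<le> n" for m n
  proof (rule power2_less_imp_less)
    show "(nm (residual u x m - residual u x n))\<^sup>2 < \<epsilon>\<^sup>2"
      using N[of m n] that residual_diff_sq[of m n] by simp
    show "0 \<le> \<epsilon>" using \<open>\<epsilon> > 0\<close> by simp
  qed
  then show "\<exists>N. \<forall>n\<ge>N. \<forall>m\<ge>N. nm (residual u x n - residual u x m) < \<epsilon>"
    by (metis nm_minus_commute nat_le_linear)
qed (rule that)

text \<open>Bessel's inequality with its exact defect, for a family that is orthogonal but not
  normalized; a zero \<open>u k\<close> contributes 0 because division by 0 yields 0.\<close>

lemma nm_residual_sq: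
  "(nm (residual u x n))\<^sup>2 = (nm x)\<^sup>2 - (\<Sum>k<n. (cmod (ip (u k) x))\<^sup>2 / (nm (u k))\<^sup>2)"
proof (induction n)
  case (Suc n)
  have "(nm (residual u x n - residual u x (Suc n)))\<^sup>2 = (cmod (ip (u n) x))\<^sup>2 / (nm (u n))\<^sup>2"
    by (cases "u n = 0")
      (auto simp: nm_scale ip_self norm_divide norm_mult power_mult_distrib power_divide power2_eq_square)
  then show ?case using Suc residual_diff_sq[of n "Suc n"] by simp
qed simp

end

end

section \<open>Bounded Hermitian forms and the operators they define\<close>

locale bounded_hermitian_form = complex_hilbert_space scaleC ip
  for scaleC :: "complex \<Rightarrow> 'a::ab_group_add \<Rightarrow> 'a" and ip :: "'a \<Rightarrow> 'a \<Rightarrow> complex" +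
  fixes V :: "'a set" and B :: "'a \<Rightarrow> 'a \<Rightarrow> complex" and M :: real
  assumes V_subspace: "subspace V"
    and form_add_right: "x \<in> V \<Longrightarrow> y \<in> V \<Longrightarrow> z \<in> V \<Longrightarrow> B x (y + z) = B x y + B x z"
    and form_scale_right: "x \<in> V \<Longrightarrow> y \<in> V \<Longrightarrow> B x (scaleC c y) = c * B x y"
    and form_commute: "x \<in> V \<Longrightarrow> y \<in> V \<Longrightarrow> B y x = cnj (B x y)"
    and form_bound: "x \<in> V \<Longrightarrow> \<bar>Re (B x x)\<bar> \<le> M * (nm x)\<^sup>2"
    and M_nonneg: "0 \<le> M"
begin

lemma V_mem: "0 \<in> V" "x \<in> V \<Longrightarrow> y \<in> V \<Longrightarrow> x + y \<in> V" "x \<in> V \<Longrightarrow> y \<in> V \<Longrightarrow> x - y \<in> V"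
  "x \<in> V \<Longrightarrow> scaleC c x \<in> V"
  using V_subspace by (auto simp: subspace_0 subspace_add subspace_diff subspace_scale)

lemma form_add_left: "x \<in> V \<Longrightarrow> y \<in> V \<Longrightarrow> z \<in> V \<Longrightarrow> B (x + y) z = B x z + B y z"
  by (metis V_mem(2) form_add_right form_commute complex_cnj_add)

lemma form_scale_left: "x \<in> V \<Longrightarrow> y \<in> V \<Longrightarrow> B (scaleC c x) y = cnj c * B x y"
  by (metis V_mem(4) form_scale_right form_commute complex_cnj_mult)

lemma form_diff_right: "x \<in> V \<Longrightarrow> y \<in> V \<Longrightarrow> z \<in> V \<Longrightarrow> B x (y - z) = B x y - B x z"
  using form_add_right[of x "y - z" z] V_mem(3)[of y z] by simp

lemma form_diff_left: "x \<in> V \<Longrightarrow> y \<in> V \<Longrightarrow> z \<in> V \<Longrightarrow> B (x - y) z = B x z - B y z"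
  using form_add_left[of "x - y" y z] V_mem(3)[of x y] by simp

lemmas form_simps = form_add_left form_add_right form_diff_left form_diff_right
  form_scale_left form_scale_right V_mem

lemma form_zero: "x \<in> V \<Longrightarrow> B x 0 = 0" "x \<in> V \<Longrightarrow> B 0 x = 0"
  using form_scale_right[of x 0 0] form_scale_left[of 0 x 0] V_mem(1) by simp_all

text \<open>Polarization followed by the parallelogram law: the bound on the diagonal carries over
  with the same constant \<open>M\<close>.\<close>

lemma form_Re_bound:
  assumes "x \<in> V" "y \<in> V"
  shows "\<bar>Re (B x y)\<bar> \<le> M / 2 * ((nm x)\<^sup>2 + (nm y)\<^sup>2)"
proof -
  have "Re (B y x) = Re (B x y)" using form_commute[OF assms] by simp
  then have "4 * Re (B x y) = Re (B (x + y) (x + y)) - Re (B (x - y) (x - y))"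
    using assms by (simp add: form_simps)
  moreover have "\<bar>Re (B (x + y) (x + y))\<bar> + \<bar>Re (B (x - y) (x - y))\<bar>
      \<le> M * (nm (x + y))\<^sup>2 + M * (nm (x - y))\<^sup>2"
    using assms V_mem by (intro add_mono form_bound) auto
  moreover have "M * (nm (x + y))\<^sup>2 + M * (nm (x - y))\<^sup>2 = 2 * M * ((nm x)\<^sup>2 + (nm y)\<^sup>2)"
    unfolding nm_add_sq nm_diff_sq by (simp add: algebra_simps)
  ultimately show ?thesis by linarith
qed

lemma form_cmod_bound:
  assumes "x \<in> V" "y \<in> V"
  shows "cmod (B x y) \<le> M * nm x * nm y"
proof (cases "x = 0 \<or> y = 0")
  case True
  then show ?thesis using assms M_nonneg by (auto simp: form_zero)
next
  case False
  then have pos: "0 < nm x" "0 < nm y"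
    by (simp_all add: nm_pos)
  \<comment> \<open>The phase that rotates \<open>B x y\<close> onto the nonnegative reals. If
    \<open>B x y = 0\<close> it is 0, which is why \<open>y'\<close> only has norm at most
    1.\<close>
  define u where "u = cnj (sgn (B x y))"
  have u: "u * B x y = of_real (cmod (B x y))" "cmod u \<le> 1"
    unfolding u_def using complex_norm_square[of "B x y"]
    by (cases "B x y = 0"; simp add: sgn_eq norm_divide power2_eq_square field_simps)+
  define x' where "x' = scaleC (1 / of_real (nm x)) x"
  define y' where "y' = scaleC (u / of_real (nm y)) y"
  have "nm x' = 1" "nm y' \<le> 1"
    using False u(2) by (simp_all add: x'_def y'_def nm_scale norm_divide)
  then have "(nm x')\<^sup>2 + (nm y')\<^sup>2 \<le> 2"
    using power_le_one[of "nm y'" 2] by simp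
  then have "M / 2 * ((nm x')\<^sup>2 + (nm y')\<^sup>2) \<le> M"
    using M_nonneg mult_left_mono[of _ 2 "M / 2"] by simp
  moreover have "Re (B x' y') = cmod (B x y) / (nm x * nm y)"
    using assms u(1) by (simp add: x'_def y'_def form_simps field_simps)
  moreover have "\<bar>Re (B x' y')\<bar> \<le> M / 2 * ((nm x')\<^sup>2 + (nm y')\<^sup>2)"
    using assms unfolding x'_def y'_def by (intro form_Re_bound V_mem)
  ultimately have "cmod (B x y) / (nm x * nm y) \<le> M" by linarith
  then show ?thesis using pos by (simp add: divide_le_eq mult.assoc)
qed

text \<open>Two uses of Riesz replace an extension by continuity. The first gives \<open>A0\<close>,
  controlled only on \<open>V\<close>; the second gives its adjoint, which is defined everywhere and
  agrees with \<open>A0\<close> on \<open>V\<close> because the form is Hermitian.\<close>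

lemma operator_of_form:
  assumes dense: "htopology ip closure_of V = UNIV"
  obtains A where "\<And>x y. A (x + y) = A x + A y" "\<And>c x. A (scaleC c x) = scaleC c (A x)"
    "\<And>x. nm (A x) \<le> M * nm x" "\<And>x y. ip (A x) y = ip x (A y)"
    "\<And>x y. x \<in> V \<Longrightarrow> y \<in> V \<Longrightarrow> ip x (A y) = B x y"
proof -
  have "\<exists>z. nm z \<le> M * nm y \<and> (\<forall>x\<in>V. B y x = ip z x)" if "y \<in> V" for y
    by (rule Riesz_on_subspace[OF V_subspace, of "B y" "M * nm y"])
      (use that M_nonneg form_cmod_bound in \<open>auto simp: form_simps\<close>)
  then obtain A0 where A0: "\<And>y. y \<in> V \<Longrightarrow> nm (A0 y) \<le> M * nm y"
      "\<And>x y. y \<in> V \<Longrightarrow> x \<in> V \<Longrightarrow> B y x = ip (A0 y) x"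
    by metis
  have A0_add: "A0 (x + y) = A0 x + A0 y" if "x \<in> V" "y \<in> V" for x y
    by (rule dense_ip_eq[OF dense]) (use that in \<open>simp add: ip_simps form_simps flip: A0(2)\<close>)
  have A0_scale: "A0 (scaleC c x) = scaleC c (A0 x)" if "x \<in> V" for c x
    by (rule dense_ip_eq[OF dense]) (use that in \<open>simp add: ip_simps form_simps flip: A0(2)\<close>)
  have "\<exists>z. nm z \<le> M * nm u \<and> (\<forall>x\<in>V. ip u (A0 x) = ip z x)" for u
  proof (rule Riesz_on_subspace[OF V_subspace, of "\<lambda>x. ip u (A0 x)" "M * nm u"])
    fix x assume x: "x \<in> V"
    have "cmod (ip u (A0 x)) \<le> nm u * nm (A0 x)" by (rule Cauchy_Schwarz)
    also have "\<dots> \<le> nm u * (M * nm x)" using A0(1)[OF x] by (simp add: mult_left_mono)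
    finally show "cmod (ip u (A0 x)) \<le> M * nm u * nm x" by (simp add: mult_ac)
  qed (use M_nonneg in \<open>auto simp: A0_add A0_scale ip_simps\<close>)
  then obtain A where A: "\<And>u. nm (A u) \<le> M * nm u" "\<And>u x. x \<in> V \<Longrightarrow> ip u (A0 x) = ip (A u) x"
    by metis
  have A_eq: "A x = A0 x" if "x \<in> V" for x
    by (rule dense_ip_eq[OF dense])
      (metis A(2) A0(2) form_commute ip_commute that)
  have add: "A (x + y) = A x + A y" for x y
    by (rule dense_ip_eq[OF dense]) (simp add: ip_simps flip: A(2))
  have scale: "A (scaleC c x) = scaleC c (A x)" for c x
    by (rule dense_ip_eq[OF dense]) (simp add: ip_simps flip: A(2))
  have sym: "ip (A x) y = ip x (A y)" for x y
  proof -
    obtain s where s: "range s \<subseteq> V" "converges s y" using dense_converges[OF dense] .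
    have "ip (A x) (s n) = ip x (A (s n))" for n
      using s(1) A(2) A_eq by (metis rangeI subsetD)
    moreover have "(\<lambda>n. ip x (A (s n))) \<longlonglongrightarrow> ip x (A y)"
      by (intro converges_ip converges_operator[OF s(2) add A(1)])
    ultimately show ?thesis
      using converges_ip[OF s(2), of "A x"] LIMSEQ_unique by auto
  qed
  have "ip x (A y) = B x y" if "x \<in> V" "y \<in> V" for x y
    using that A0(2) A_eq sym by metis
  with that[OF add scale A(1) sym] show ?thesis by blast
qed

end

section \<open>Hankel forms over a shift of multiplicity one\<close>

lemma (in complex_hilbert_space) unitary_operator_iff:
  "unitary_operator scaleC ip W \<longleftrightarrow>
     (\<forall>x y. W (x + y) = W x + W y) \<and> (\<forall>c x. W (scaleC c x) = scaleC c (W x)) \<and>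
     surj W \<and> (\<forall>x y. ip (W x) (W y) = ip x y)"
  using vector_space_axioms by (auto simp: unitary_operator_def Vector_Spaces.linear_iff)

locale invariant_subspace = complex_hilbert_space scaleC ip
  for scaleC :: "complex \<Rightarrow> 'a::ab_group_add \<Rightarrow> 'a" and ip :: "'a \<Rightarrow> 'a \<Rightarrow> complex" +
  fixes Ep :: "'a set" and U :: "'a \<Rightarrow> 'a"
  assumes unitary_U: "unitary_operator scaleC ip U"
    and closed_Ep: "closed_subspace scaleC ip Ep"
    and U_in_Ep: "x \<in> Ep \<Longrightarrow> U x \<in> Ep"
begin

lemma U_add: "U (x + y) = U x + U y"
  and U_scale: "U (scaleC c x) = scaleC c (U x)"
  and surj_U: "surj U"
  and ip_U_U [simp]: "ip (U x) (U y) = ip x y"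
  using unitary_U by (auto simp: unitary_operator_iff)

lemma U_zero [simp]: "U 0 = 0"
  using U_add[of 0 0] by simp

lemma U_diff: "U (x - y) = U x - U y"
  using U_add[of "x - y" y] by simp

lemma nm_U [simp]: "nm (U x) = nm x"
  by (simp add: hnorm_def)

lemma inj_U: "inj U"
proof (rule injI)
  fix x y assume "U x = U y"
  then have "nm (U (x - y)) = 0" by (simp add: U_diff)
  then show "x = y" by simp
qed

lemma U_inv [simp]: "U (inv U x) = x" and inv_U [simp]: "inv U (U x) = x"
  using surj_U inj_U by (simp_all add: surj_f_inv_f)

lemma U_eq_iff: "U x = U y \<longleftrightarrow> x = y"
  using inj_U by (rule inj_eq)

lemma inv_U_add: "inv U (x + y) = inv U x + inv U y"
  and inv_U_scale: "inv U (scaleC c x) = scaleC c (inv U x)"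
  and inv_U_diff: "inv U (x - y) = inv U x - inv U y"
  by (simp_all add: U_add U_scale U_diff flip: U_eq_iff)

lemma Ep_mem: "0 \<in> Ep" "x \<in> Ep \<Longrightarrow> y \<in> Ep \<Longrightarrow> x + y \<in> Ep" "x \<in> Ep \<Longrightarrow> y \<in> Ep \<Longrightarrow> x - y \<in> Ep"
  "x \<in> Ep \<Longrightarrow> scaleC c x \<in> Ep"
  using closed_Ep by (auto simp: closed_subspace_iff subspace_0 subspace_add subspace_diff subspace_scale)

lemma Ep_limit: "(\<And>n. s n \<in> Ep) \<Longrightarrow> converges s z \<Longrightarrow> z \<in> Ep"
  using closed_Ep by (auto simp: closed_subspace_iff image_subset_iff)

lemma Un_Un: "(U ^^ m) ((U ^^ n) x) = (U ^^ (m + n)) x"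
  by (simp add: funpow_add)

lemma Un_add: "(U ^^ n) (x + y) = (U ^^ n) x + (U ^^ n) y"
  by (induction n) (simp_all add: U_add)

lemma Un_scale: "(U ^^ n) (scaleC c x) = scaleC c ((U ^^ n) x)"
  by (induction n) (simp_all add: U_scale)

lemma ip_Un_Un [simp]: "ip ((U ^^ n) x) ((U ^^ n) y) = ip x y"
  by (induction n) simp_all

lemma nm_Un [simp]: "nm ((U ^^ n) x) = nm x"
  by (simp add: hnorm_def)

lemma Un_Ep: "x \<in> Ep \<Longrightarrow> (U ^^ n) x \<in> Ep"
  by (induction n) (simp_all add: U_in_Ep)

lemma Un_Ep_mono: "(U ^^ m) x \<in> Ep \<Longrightarrow> m \<le> n \<Longrightarrow> (U ^^ n) x \<in> Ep"
  using Un_Ep[of "(U ^^ m) x" "n - m"] by (simp add: Un_Un)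

lemma Un_inv: "(U ^^ n) ((inv U ^^ n) x) = x" and inv_Un: "(inv U ^^ n) ((U ^^ n) x) = x"
  using fn_o_inv_fn_is_id[of U n] inv_fn_o_fn_is_id[of U n] surj_U inj_U
  by (simp_all add: bij_def fun_eq_iff)

end

text \<open>The Wold model with wandering subspace spanned by the unit vector \<open>e\<close>.
  Regularity is phrased with powers \<open>U ^^ n\<close> alone: the dense set is the union of the
  preimages of \<open>Ep\<close>, that is, of the spaces \<open>U^-n Ep\<close>.\<close>

locale simple_shift = invariant_subspace scaleC ip Ep U
  for scaleC :: "complex \<Rightarrow> 'a::ab_group_add \<Rightarrow> 'a" and ip :: "'a \<Rightarrow> 'a \<Rightarrow> complex"
    and Ep :: "'a set" and U :: "'a \<Rightarrow> 'a" +
  fixes e :: 'a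
  assumes e_in_Ep: "e \<in> Ep"
    and ip_e_e: "ip e e = 1"
    and ip_e_U: "x \<in> Ep \<Longrightarrow> ip e (U x) = 0"
    and decomposition: "x \<in> Ep \<Longrightarrow> \<exists>z\<in>Ep. x = scaleC (ip e x) e + U z"
    and Inter_trivial: "(\<And>n. x \<in> (U ^^ n) ` Ep) \<Longrightarrow> x = 0"
    and Union_dense: "htopology ip closure_of {x. \<exists>n. (U ^^ n) x \<in> Ep} = UNIV"
begin

text \<open>In the model \<open>H^2\<close> of the disc this is the backward shift
  \<open>(x - x(0)) / z\<close>.\<close>

definition tail :: "'a \<Rightarrow> 'a" where "tail x = inv U (x - scaleC (ip e x) e)"

lemma head_tail: "x = scaleC (ip e x) e + U (tail x)"
  by (simp add: tail_def)

lemma tail_Ep: "x \<in> Ep \<Longrightarrow> tail x \<in> Ep"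
  using decomposition[of x] by (auto simp: tail_def) (metis inv_U add_diff_cancel_left')

lemma tail_add: "tail (x + y) = tail x + tail y"
  by (simp add: tail_def ip_simps scale_left_distrib algebra_simps flip: inv_U_add)

lemma tail_scale: "tail (scaleC c x) = scaleC c (tail x)"
  by (simp add: tail_def ip_simps scale_right_diff_distrib flip: inv_U_scale)

lemma tail_U: "x \<in> Ep \<Longrightarrow> tail (U x) = x"
  by (simp add: tail_def ip_e_U)

lemma nm_head_tail:
  assumes "x \<in> Ep"
  shows "(nm x)\<^sup>2 = (cmod (ip e x))\<^sup>2 + (nm (tail x))\<^sup>2"
proof -
  have "nm e = 1" by (simp add: hnorm_def ip_e_e)
  have "(nm x)\<^sup>2 = (nm (scaleC (ip e x) e + U (tail x)))\<^sup>2"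
    using head_tail by simp
  also have "\<dots> = (cmod (ip e x))\<^sup>2 + (nm (tail x))\<^sup>2"
    using ip_e_U[OF tail_Ep[OF assms]] \<open>nm e = 1\<close> by (simp add: nm_add_sq nm_scale ip_simps)
  finally show ?thesis .
qed

lemma ip_e_Un: "x \<in> Ep \<Longrightarrow> n > 0 \<Longrightarrow> ip e ((U ^^ n) x) = 0"
  by (cases n) (simp_all add: ip_e_U Un_Ep)

lemma basis_orthogonal: "m \<noteq> n \<Longrightarrow> ip ((U ^^ m) e) ((U ^^ n) e) = 0"
proof (induction m n rule: linorder_wlog)
  case (le m n)
  then have "ip ((U ^^ m) e) ((U ^^ m) ((U ^^ (n - m)) e)) = 0"
    by (simp add: ip_e_Un e_in_Ep)
  with le show ?case by (simp add: Un_Un)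
next
  case (sym m n)
  then show ?case by (metis ip_commute complex_cnj_zero)
qed

text \<open>This exhibits the remainder as an element of \<open>U^n Ep\<close>, which later places
  the limit of the remainders in the intersection.\<close>

lemma residual_basis:
  assumes "x \<in> Ep"
  shows "residual (\<lambda>k. (U ^^ k) e) x n = (U ^^ n) ((tail ^^ n) x)"
proof (induction n)
  case (Suc n)
  let ?y = "(tail ^^ n) x"
  have "ip ((U ^^ n) e) ((U ^^ n) ?y) = ip ((U ^^ n) e) x"
    using ip_residual[of "\<lambda>k. (U ^^ k) e" n x n] basis_orthogonal Suc by simp
  then have "ip ((U ^^ n) e) x = ip e ?y" by simp
  moreover have "(U ^^ n) ?y = scaleC (ip e ?y) ((U ^^ n) e) + (U ^^ n) (U (tail ?y))"
    using arg_cong[OF head_tail[of ?y], of "U ^^ n"] by (simp add: Un_add Un_scale)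
  ultimately show ?case using Suc by (simp add: ip_e_e funpow_swap1)
qed simp

text \<open>From index \<open>n\<close> on the remainders lie in the closed subspace
  \<open>U^n Ep\<close>. So does their limit, and the intersection of these subspaces is
  trivial.\<close>

lemma basis_complete:
  assumes "x \<in> Ep"
  shows "converges (residual (\<lambda>k. (U ^^ k) e) x) 0"
proof -
  let ?r = "residual (\<lambda>k. (U ^^ k) e) x"
  obtain r where r: "converges ?r r"
    using residual_converges[of "\<lambda>k. (U ^^ k) e" x] basis_orthogonal by blast
  have "r \<in> (U ^^ n) ` Ep" for n
  proof -
    have surj: "surj (U ^^ n)" using surj_U by (rule surj_fn)
    have "(U ^^ n) ((U ^^ k) ((tail ^^ (n + k)) x)) = ?r (k + n)" for k
      unfolding residual_basis[OF assms] by (simp add: add.commute Un_Un)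
    moreover have "converges (\<lambda>k. ?r (k + n)) r"
      using r unfolding converges_def by (rule LIMSEQ_ignore_initial_segment)
    ultimately have lim: "converges (\<lambda>k. (U ^^ n) ((U ^^ k) ((tail ^^ (n + k)) x))) r" by simp
    obtain z where z: "r = (U ^^ n) z" using surj by (metis surjD)
    have lim_z: "converges (\<lambda>k. (U ^^ k) ((tail ^^ (n + k)) x)) z"
    proof (rule converges_isometric[OF lim])
      fix k
      let ?y = "(U ^^ k) ((tail ^^ (n + k)) x)"
      have "nm (?y - z) = nm ((U ^^ n) (?y - z))" by (rule nm_Un[symmetric])
      moreover have "(U ^^ n) (?y - z) = (U ^^ n) ?y - r"
        using Un_add[of n "?y - z" z] z by simp
      ultimately show "nm (?y - z) \<le> 1 * nm ((U ^^ n) ?y - r)" by simp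
    qed
    have "(tail ^^ j) x \<in> Ep" for j
      using assms by (induction j) (simp_all add: tail_Ep)
    then have "z \<in> Ep" by (intro Ep_limit[OF _ lim_z] Un_Ep)
    then show ?thesis using z by blast
  qed
  then have "r = 0" by (rule Inter_trivial)
  then show ?thesis using r by simp
qed

text \<open>
  The operators commuting with \<open>U\<close> are the multiplications by bounded functions on the circle, so
  this is the theorem that a nonzero function in \<open>H\<^sup>2\<close> cannot vanish on a set of positive measure.
  The vector \<open>w\<close> of the proof is a multiple of an inner function; Parseval's identity
  for \<open>w\<close> says that Bessel's inequality for \<open>e\<close> and the orthogonal family \<open>U\<^sup>-\<^sup>n w\<close> is an equality.
\<close>

lemma commuting_operator_eq_0:
  assumes add: "\<And>y z. L (y + z) = L y + L z" and scale: "\<And>c y. L (scaleC c y) = scaleC c (L y)"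
    and bound: "\<And>x. nm (L x) \<le> C * nm x" and LU: "\<And>x. L (U x) = U (L x)"
    and f: "f \<in> Ep" "ip e f \<noteq> 0" "L f = 0"
  shows "L x = 0"
proof -
  have L0: "L 0 = 0" using scale[of 0 0] by simp
  have L_limit: "L x = 0" if "converges (residual u x) 0" "\<And>k. L (u k) = 0" for u x
  proof -
    have "converges (\<lambda>n. L (residual u x n)) (L 0)"
      by (rule converges_operator[OF that(1) add bound])
    then have "converges (\<lambda>n. L x) 0"
      unfolding operator_residual[of L u x, OF add scale that(2)] L0 .
    then show ?thesis using converges_const converges_unique by blast
  qed
  \<comment> \<open>The vector \<open>w\<close> obtained below is the projection of \<open>e\<close>
    to this kernel. It is nonzero because \<open>f\<close> lies in the kernel and is not orthogonal
    to \<open>e\<close>.\<close>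
  define V where "V = {x \<in> Ep. L x = 0}"
  have "subspace V"
    by (rule subspaceI) (auto simp: V_def Ep_mem L0 add scale)
  then obtain s w where s: "range s \<subseteq> V" "converges s w" and w: "\<And>v. v \<in> V \<Longrightarrow> ip e v = ip w v"
    by (rule Riesz_on_subspace[of V "ip e" "nm e"]) (auto simp: ip_simps Cauchy_Schwarz)
  have "w \<in> Ep" using s(1) by (intro Ep_limit[OF _ s(2)]) (auto simp: V_def)
  have "converges (\<lambda>n. L (s n)) (L w)" by (rule converges_operator[OF s(2) add bound])
  moreover have "(\<lambda>n. L (s n)) = (\<lambda>n. 0)" using s(1) by (auto simp: V_def)
  ultimately have "L w = 0" using converges_const converges_unique by metis
  have "w \<noteq> 0" using w[of f] f by (auto simp: V_def)
  \<comment> \<open>\<open>U^k w\<close> is again in \<open>V\<close>, where pairing with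
    \<open>w\<close> is pairing with \<open>e\<close>, and \<open>e\<close> is orthogonal to
    \<open>U Ep\<close>. In function space: \<open>w\<close> has constant modulus.\<close>
  have w_orth: "ip w ((U ^^ k) w) = 0" if "k > 0" for k
  proof -
    have "L ((U ^^ k) w) = (U ^^ k) (L w)" by (induction k) (simp_all add: LU)
    also have "\<dots> = 0" using Un_scale[of k 0 0] \<open>L w = 0\<close> by simp
    finally show ?thesis
      using w[of "(U ^^ k) w"] that \<open>w \<in> Ep\<close> by (simp add: V_def Un_Ep ip_e_Un)
  qed
  define u where "u n = (inv U ^^ n) w" for n
  have u_Suc: "U (u (Suc n)) = u n" for n by (simp add: u_def)
  have Un_u: "(U ^^ n) (u n) = w" for n
  proof (induction n)
    case (Suc n)
    have "(U ^^ Suc n) (u (Suc n)) = (U ^^ n) (U (u (Suc n)))" by (simp only: funpow_Suc_right o_apply)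
    then show ?case using Suc by (simp add: u_Suc)
  qed (simp add: u_def)
  have "L (u n) = 0" for n
  proof (induction n)
    case 0
    then show ?case using \<open>L w = 0\<close> by (simp add: u_def)
  next
    case (Suc n)
    then show ?case using LU[of "u (Suc n)"] by (metis u_Suc U_zero U_eq_iff)
  qed
  have u_orth: "ip (u m) (u n) = 0" if "m \<noteq> n" for m n
    using that
  proof (induction m n rule: linorder_wlog)
    case (le m n)
    have "(U ^^ n) (u m) = (U ^^ (n - m)) ((U ^^ m) (u m))"
      using le by (simp add: Un_Un)
    then have "ip (u m) (u n) = ip ((U ^^ (n - m)) w) w"
      using ip_Un_Un[of n "u m" "u n"] by (simp add: Un_u)
    then show ?case using w_orth[of "n - m"] le by (metis ip_commute complex_cnj_zero zero_less_diff le_neq_implies_less)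
  next
    case (sym m n)
    then show ?case by (metis ip_commute complex_cnj_zero)
  qed
  have "nm e = 1" by (simp add: hnorm_def ip_e_e)
  have nm_u: "nm (u k) = nm w" for k using nm_Un[of k "u k"] by (simp add: Un_u)
  \<comment> \<open>The coefficients of \<open>e\<close> along \<open>U^-k w\<close> are conjugate
    to those of \<open>w\<close> along \<open>U^k e\<close>, so the two Bessel defects differ only
    by the factor \<open>(nm w)^2\<close>.\<close>
  have "nm (residual u e n) = nm (residual (\<lambda>k. (U ^^ k) e) w n) / nm w" for n
  proof -
    have "cmod (ip (u k) e) = cmod (ip ((U ^^ k) e) w)" for k
      using ip_Un_Un[of k "u k" e] ip_commute[of "(U ^^ k) e" w] by (simp add: Un_u)
    then have "(nm (residual u e n))\<^sup>2 = (nm (residual (\<lambda>k. (U ^^ k) e) w n))\<^sup>2 / (nm w)\<^sup>2"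
      using \<open>w \<noteq> 0\<close> nm_residual_sq[of u e n, OF u_orth]
        nm_residual_sq[of "\<lambda>k. (U ^^ k) e" w n, OF basis_orthogonal]
      by (simp add: nm_u \<open>nm e = 1\<close> diff_divide_distrib sum_divide_distrib)
    then show ?thesis by (simp flip: power_divide)
  qed
  then have "converges (residual u e) 0"
    using tendsto_divide[OF basis_complete[OF \<open>w \<in> Ep\<close>, unfolded converges_def] tendsto_const, of "nm w"] \<open>w \<noteq> 0\<close>
    by (simp add: converges_def)
  \<comment> \<open>From \<open>e\<close> the vanishing spreads to all \<open>U^k e\<close>, then to
    \<open>Ep\<close> by completeness of the basis, and finally to the whole space by
    density.\<close>
  then have "L e = 0" using L_limit \<open>\<And>n. L (u n) = 0\<close> by blast
  then have "L ((U ^^ k) e) = 0" for k by (induction k) (simp_all add: LU)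
  then have Ep0: "L x = 0" if "x \<in> Ep" for x
    using L_limit basis_complete[OF that] by blast
  obtain s where s: "range s \<subseteq> {x. \<exists>n. (U ^^ n) x \<in> Ep}" "converges s x"
    using dense_converges[OF Union_dense] .
  have "L (s n) = 0" for n
  proof -
    obtain k where "(U ^^ k) (s n) \<in> Ep" using s(1) by blast
    then have "L ((U ^^ k) (s n)) = 0" by (rule Ep0)
    moreover have "L ((U ^^ k) y) = (U ^^ k) (L y)" for y by (induction k) (simp_all add: LU)
    ultimately have "nm (L (s n)) = 0" using nm_Un[of k "L (s n)"] by simp
    then show ?thesis by simp
  qed
  moreover have "converges (\<lambda>n. L (s n)) (L x)" by (rule converges_operator[OF s(2) add bound])
  ultimately show ?thesis using converges_const[of 0] converges_unique by auto
qed

end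

section \<open>Extending a Hankel form by one coefficient\<close>

locale hankel_form = simple_shift scaleC ip Ep U e + bounded_hermitian_form scaleC ip Ep B M
  for scaleC :: "complex \<Rightarrow> 'a::ab_group_add \<Rightarrow> 'a" and ip :: "'a \<Rightarrow> 'a \<Rightarrow> complex"
    and Ep :: "'a set" and U :: "'a \<Rightarrow> 'a" and e :: 'a and B :: "'a \<Rightarrow> 'a \<Rightarrow> complex" and M :: real +
  assumes hankel: "x \<in> Ep \<Longrightarrow> y \<in> Ep \<Longrightarrow> B (U x) y = B x (U y)"
begin

text \<open>
  In the orthonormal basis \<open>U\<^sup>n e\<close> of \<open>Ep\<close> the form \<open>B\<close> has a Hankel matrix \<open>(a\<^sub>j\<^sub>+\<^sub>k)\<close>;
  the following form has the matrix \<open>(a\<^sub>j\<^sub>+\<^sub>k\<^sub>-\<^sub>1)\<close> with \<open>a\<^sub>-\<^sub>1 = t\<close>.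
\<close>

definition extension :: "real \<Rightarrow> 'a \<Rightarrow> 'a \<Rightarrow> complex" where
  "extension t x y = of_real t * cnj (ip e x) * ip e y + cnj (ip e x) * B e (tail y)
     + ip e y * B (tail x) e + B (tail x) (U (tail y))"

text \<open>For \<open>x = e + U v\<close> with \<open>v\<close> in \<open>Ep\<close> the squared
  norm is \<open>1 + (nm v)^2\<close>, and the bound of \<open>extension t\<close> at
  \<open>x\<close> says exactly \<open>lower v <= t <= upper v\<close>.\<close>

definition upper :: "'a \<Rightarrow> real" where
  "upper v = M + M * (nm v)\<^sup>2 - 2 * Re (B e v) - Re (B v (U v))"

definition lower :: "'a \<Rightarrow> real" where
  "lower v = - M - M * (nm v)\<^sup>2 - 2 * Re (B e v) - Re (B v (U v))"

text \<open>The compatibility condition in Parrott's argument. With \<open>s = v - w\<close> and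
  \<open>p = v + w\<close>, the difference of the two sides is \<open>Re (B s (2 e + U p))\<close>
  plus \<open>M / 2\<close> times the sum of the squared norms of \<open>s\<close> and
  \<open>2 e + U p\<close>; the mixed terms cancel by Hankel symmetry, and
  \<open>form_Re_bound\<close> applies.\<close>

lemma lower_le_upper:
  assumes "v \<in> Ep" "w \<in> Ep"
  shows "lower v \<le> upper w"
proof -
  define s where "s = v - w"
  define p where "p = v + w"
  have mem: "s \<in> Ep" "p \<in> Ep" "U v \<in> Ep" "U w \<in> Ep"
    using assms by (auto simp: s_def p_def Ep_mem U_in_Ep)
  have Ue: "nm (scaleC 2 e + U p) ^ 2 = 4 + (nm p)\<^sup>2"
  proof -
    have "nm e = 1" by (simp add: hnorm_def ip_e_e)
    then show ?thesis using mem by (simp add: nm_add_sq nm_scale ip_simps ip_e_U)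
  qed
  have "Re (B s (U p)) = Re (B v (U v)) - Re (B w (U w))"
  proof -
    have "B w (U v) = cnj (B v (U w))"
      using assms mem by (metis form_commute hankel)
    then show ?thesis using assms mem by (simp add: s_def p_def U_add form_simps)
  qed
  moreover have "Re (B s (scaleC 2 e + U p)) = 2 * Re (B e v) - 2 * Re (B e w) + Re (B s (U p))"
  proof -
    have "Re (B s e) = Re (B e s)"
      using form_commute[OF mem(1) e_in_Ep] by simp
    then show ?thesis
      using mem assms e_in_Ep by (simp add: form_simps U_in_Ep) (simp add: s_def form_simps)
  qed
  moreover have "\<bar>Re (B s (scaleC 2 e + U p))\<bar> \<le> M / 2 * ((nm s)\<^sup>2 + (4 + (nm p)\<^sup>2))"
    using form_Re_bound[of s "scaleC 2 e + U p"] mem e_in_Ep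
    unfolding Ue by (simp add: Ep_mem U_in_Ep)
  moreover have "M / 2 * ((nm s)\<^sup>2 + (4 + (nm p)\<^sup>2)) = 2 * M + M * (nm v)\<^sup>2 + M * (nm w)\<^sup>2"
    unfolding s_def p_def nm_add_sq nm_diff_sq by (simp add: field_simps)
  ultimately show ?thesis unfolding lower_def upper_def by linarith
qed

text \<open>Removing the first column or the first row of the matrix \<open>a_(j+k-1)\<close> leaves
  \<open>a_(j+k)\<close>, whatever \<open>t\<close> is.\<close>

lemma extension_U:
  assumes "x \<in> Ep" "y \<in> Ep"
  shows "extension t x (U y) = B x y" "extension t (U x) y = B x y"
proof -
  have "B x y = B (scaleC (ip e x) e + U (tail x)) y" "B x y = B x (scaleC (ip e y) e + U (tail y))"
    using head_tail by simp_all
  then show "extension t x (U y) = B x y" "extension t (U x) y = B x y"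
    using assms e_in_Ep
    by (simp_all add: extension_def ip_e_U tail_U form_simps U_in_Ep tail_Ep hankel)
qed

lemma extension_hankel_form:
  assumes t: "\<And>v. v \<in> Ep \<Longrightarrow> t \<le> upper v" "\<And>v. v \<in> Ep \<Longrightarrow> lower v \<le> t"
  shows "hankel_form scaleC ip Ep U e (extension t) M"
proof unfold_locales
  fix x assume x: "x \<in> Ep"
  show "\<bar>Re (extension t x x)\<bar> \<le> M * (nm x)\<^sup>2"
  proof (cases "ip e x = 0")
    case True
    then show ?thesis
      using form_Re_bound[of "tail x" "U (tail x)"] x unfolding nm_head_tail[OF x]
      by (simp add: extension_def tail_Ep U_in_Ep)
  next
    case False
    \<comment> \<open>By homogeneity, \<open>x = c (e + U v)\<close> reduces the bound to the
      admissible interval for \<open>t\<close>. In the case \<open>ip e x = 0\<close> treated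
      before, \<open>t\<close> drops out.\<close>
    define c where "c = ip e x"
    define v where "v = scaleC (1 / c) (tail x)"
    have "c \<noteq> 0" using False by (simp add: c_def)
    then have tl: "tail x = scaleC c v" by (simp add: v_def)
    have v: "v \<in> Ep" using x by (simp add: v_def tail_Ep Ep_mem)
    have "Re (B v e) = Re (B e v)" using form_commute[OF v e_in_Ep] by simp
    moreover have "extension t x x = cnj c * c * (of_real t + B e v + B v e + B v (U v))"
      using v e_in_Ep unfolding extension_def tl c_def[symmetric]
      by (simp add: U_scale form_simps U_in_Ep) (simp add: algebra_simps)
    moreover have "cnj c * c = of_real ((cmod c)\<^sup>2)"
      using complex_norm_square[of c] by (simp add: mult.commute)
    ultimately have "Re (extension t x x) = (cmod c)\<^sup>2 * (t + 2 * Re (B e v) + Re (B v (U v)))"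
      by simp
    moreover have "\<bar>t + 2 * Re (B e v) + Re (B v (U v))\<bar> \<le> M + M * (nm v)\<^sup>2"
      using t[OF v] unfolding upper_def lower_def by linarith
    ultimately have "\<bar>Re (extension t x x)\<bar> \<le> (cmod c)\<^sup>2 * (M + M * (nm v)\<^sup>2)"
      by (simp add: abs_mult mult_left_mono)
    also have "\<dots> = M * (nm x)\<^sup>2"
      unfolding nm_head_tail[OF x] tl nm_scale c_def[symmetric]
      by (simp add: power_mult_distrib algebra_simps)
    finally show ?thesis .
  qed
next
  fix x y assume "x \<in> Ep" "y \<in> Ep"
  then show "extension t (U x) y = extension t x (U y)" by (simp add: extension_U)
  show "extension t x (scaleC c y) = c * extension t x y" for c
    using \<open>x \<in> Ep\<close> \<open>y \<in> Ep\<close> e_in_Ep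
    by (simp add: extension_def tail_scale U_scale ip_simps form_simps tail_Ep U_in_Ep)
      (simp add: algebra_simps)
  have "B e (tail y) = cnj (B (tail y) e)" "B (tail x) e = cnj (B e (tail x))"
    "B (tail y) (U (tail x)) = cnj (B (tail x) (U (tail y)))"
    using \<open>x \<in> Ep\<close> \<open>y \<in> Ep\<close> e_in_Ep by (metis form_commute hankel tail_Ep U_in_Ep)+
  then show "extension t y x = cnj (extension t x y)"
    by (simp add: extension_def algebra_simps)
next
  fix x y z assume "x \<in> Ep" "y \<in> Ep" "z \<in> Ep"
  then show "extension t x (y + z) = extension t x y + extension t x z"
    using e_in_Ep
    by (simp add: extension_def tail_add U_add ip_simps form_simps tail_Ep U_in_Ep)
      (simp add: algebra_simps)
qed (use V_subspace M_nonneg in auto)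

lemma extension_exists:
  obtains t where "hankel_form scaleC ip Ep U e (extension t) M"
proof -
  let ?t = "SUP v\<in>Ep. lower v"
  have "lower v \<le> ?t" if "v \<in> Ep" for v
    using that lower_le_upper[OF _ that] by (intro cSUP_upper bdd_aboveI2)
  moreover have "?t \<le> upper v" if "v \<in> Ep" for v
    using that lower_le_upper by (intro cSUP_least) auto
  ultimately show ?thesis using that extension_hankel_form by blast
qed

text \<open>
  The maximal admissible \<open>t\<close> makes \<open>M\<close> an eigenvalue; the eigenvector is found by completing the
  square in \<open>upper\<close>.
\<close>

lemma extremal_extension:
  assumes y: "y \<in> Ep" and eq: "\<And>v. v \<in> Ep \<Longrightarrow> B v (e + U y) = of_real M * ip v y"
  shows "hankel_form scaleC ip Ep U e (extension (upper y)) M"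
    and "x \<in> Ep \<Longrightarrow> extension (upper y) x (e + U y) = of_real M * ip x (e + U y)"
proof -
  have B_eq: "B v e + B v (U y) = of_real M * ip v y" if "v \<in> Ep" for v
    using eq[OF that] that y e_in_Ep by (simp add: form_simps U_in_Ep)
  \<comment> \<open>Expansion about \<open>y\<close>: the hypothesis \<open>eq\<close> cancels the
    terms linear in \<open>s = v - y\<close> and leaves \<open>M (nm s)^2 - Re (B s (U s))\<close>,
    which is nonnegative.\<close>
  have "upper y \<le> upper v" if v: "v \<in> Ep" for v
  proof -
    define s where "s = v - y"
    have s: "s \<in> Ep" and v_eq: "v = y + s" using v y by (auto simp: s_def Ep_mem)
    have "Re (B s e) = Re (B e s)" using form_commute[OF s e_in_Ep] by simp
    then have "Re (B e s) + Re (B s (U y)) = M * Re (ip s y)"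
      using arg_cong[OF B_eq[OF s], of Re] by simp
    moreover have "Re (B v (U v)) = Re (B y (U y)) + 2 * Re (B s (U y)) + Re (B s (U s))"
    proof -
      have "B y (U s) = cnj (B s (U y))" using s y by (metis form_commute hankel U_in_Ep)
      then show ?thesis unfolding v_eq using s y by (simp add: U_add form_simps U_in_Ep)
    qed
    moreover have "Re (B e v) = Re (B e y) + Re (B e s)"
      unfolding v_eq using s y e_in_Ep by (simp add: form_simps)
    moreover have "M * (nm v)\<^sup>2 = M * (nm y)\<^sup>2 + M * (nm s)\<^sup>2 + 2 * (M * Re (ip s y))"
      unfolding v_eq nm_add_sq Re_ip_commute[of y s] by (simp add: algebra_simps)
    moreover have "\<bar>Re (B s (U s))\<bar> \<le> M * (nm s)\<^sup>2"
      using form_Re_bound[of s "U s"] s by (simp add: U_in_Ep)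
    ultimately show ?thesis unfolding upper_def by linarith
  qed
  then show "hankel_form scaleC ip Ep U e (extension (upper y)) M"
    using y by (intro extension_hankel_form lower_le_upper)
  \<comment> \<open>The row of the eigenvalue equation that belongs to \<open>e\<close>; the other
    rows are \<open>B_eq\<close>.\<close>
  have "of_real (upper y) + B e y = of_real M"
  proof -
    have "B y (U y) = cnj (B y (U y))" using y by (metis form_commute hankel U_in_Ep)
    then have "Im (B y (U y)) = 0" by (simp add: complex_eq_iff)
    then have "Im (B y e) = 0" and "Re (B y e) + Re (B y (U y)) = M * (nm y)\<^sup>2"
      using B_eq[OF y] by (simp_all add: ip_self complex_eq_iff)
    moreover have "B e y = cnj (B y e)" using form_commute[OF y e_in_Ep] .
    ultimately show ?thesis by (simp add: upper_def complex_eq_iff)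
  qed
  note t_eq = this
  assume x: "x \<in> Ep"
  have "ip e (e + U y) = 1" "tail (e + U y) = y"
    using y by (simp_all add: ip_simps ip_e_e ip_e_U tail_def)
  then have "extension (upper y) x (e + U y)
      = cnj (ip e x) * (of_real (upper y) + B e y) + (B (tail x) e + B (tail x) (U y))"
    by (simp add: extension_def algebra_simps)
  also have "\<dots> = of_real M * (cnj (ip e x) + ip (tail x) y)"
    unfolding t_eq B_eq[OF tail_Ep[OF x]] by (simp add: algebra_simps)
  also have "cnj (ip e x) + ip (tail x) y = ip x (e + U y)"
  proof -
    have "ip x (U y) = ip (scaleC (ip e x) e + U (tail x)) (U y)" using head_tail by simp
    then show ?thesis using y ip_commute[of e x] by (simp add: ip_simps ip_e_U)
  qed
  finally show "extension (upper y) x (e + U y) = of_real M * ip x (e + U y)" .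
qed

text \<open>Dependent choice iterates the one-step extension: \<open>Bs n\<close> has the matrix
  \<open>a_(j+k-n)\<close> in the basis \<open>U^j e\<close>, always with the same bound
  \<open>M\<close>.\<close>

lemma extension_chain:
  obtains Bs where "Bs 0 = B" "\<And>n. hankel_form scaleC ip Ep U e (Bs n) M"
    "\<And>n x y. x \<in> Ep \<Longrightarrow> y \<in> Ep \<Longrightarrow> Bs (Suc n) x (U y) = Bs n x y"
proof -
  let ?P = "\<lambda>n B'. hankel_form scaleC ip Ep U e B' M \<and> (n = 0 \<longrightarrow> B' = B)"
  have "\<exists>Bs. \<forall>n. ?P n (Bs n) \<and> (\<forall>x\<in>Ep. \<forall>y\<in>Ep. Bs (Suc n) x (U y) = Bs n x y)"
  proof (rule dependent_nat_choice)
    show "\<exists>B'. ?P 0 B'" using hankel_form_axioms by auto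
  next
    fix B' and n :: nat
    assume "?P n B'"
    then interpret B': hankel_form scaleC ip Ep U e B' M by simp
    obtain t where "hankel_form scaleC ip Ep U e (B'.extension t) M"
      by (rule B'.extension_exists)
    then show "\<exists>B''. ?P (Suc n) B'' \<and> (\<forall>x\<in>Ep. \<forall>y\<in>Ep. B'' x (U y) = B' x y)"
      using B'.extension_U by auto
  qed
  then show ?thesis using that by blast
qed

text \<open>Nehari's theorem in self-adjoint form. The forms \<open>Bs (2 * n)\<close> are pulled
  back along \<open>U^n\<close> and glued to a form on the union of the \<open>U^-n Ep\<close>; the
  factor 2 is there because both arguments are shifted.\<close>

lemma Nehari_extension:
  obtains A where "\<And>x y. A (x + y) = A x + A y" "\<And>c x. A (scaleC c x) = scaleC c (A x)"
    "\<And>x. nm (A x) \<le> M * nm x" "\<And>x y. ip (A x) y = ip x (A y)" "\<And>x. A (U x) = inv U (A x)"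
    "\<And>x y. x \<in> Ep \<Longrightarrow> y \<in> Ep \<Longrightarrow> ip x (A y) = B x y"
proof -
  obtain Bs where Bs0: "Bs 0 = B" and Bs_form: "\<And>n. hankel_form scaleC ip Ep U e (Bs n) M"
    and Bs_U: "\<And>n x y. x \<in> Ep \<Longrightarrow> y \<in> Ep \<Longrightarrow> Bs (Suc n) x (U y) = Bs n x y"
    by (rule extension_chain) blast
  define D where "D = {x. \<exists>n. (U ^^ n) x \<in> Ep}"
  have step: "Bs (2 * (n + k)) ((U ^^ k) x) ((U ^^ k) y) = Bs (2 * n) x y"
    if "x \<in> Ep" "y \<in> Ep" for n k x y
  proof (induction k)
    case (Suc k)
    interpret Bk: hankel_form scaleC ip Ep U e "Bs (Suc (2 * (n + k)))" M by (rule Bs_form)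
    show ?case using that Suc Bk.hankel by (simp add: Bs_U Un_Ep U_in_Ep)
  qed simp
  \<comment> \<open>By \<open>step\<close> every admissible \<open>n\<close> gives the same value;
    the least one is merely a choice.\<close>
  define G where
    "G x y = (let n = LEAST n. (U ^^ n) x \<in> Ep \<and> (U ^^ n) y \<in> Ep in Bs (2 * n) ((U ^^ n) x) ((U ^^ n) y))"
    for x y
  have G_eq: "G x y = Bs (2 * n) ((U ^^ n) x) ((U ^^ n) y)"
    if "(U ^^ n) x \<in> Ep" "(U ^^ n) y \<in> Ep" for n x y
  proof -
    define m where "m = (LEAST n. (U ^^ n) x \<in> Ep \<and> (U ^^ n) y \<in> Ep)"
    have "(U ^^ m) x \<in> Ep" "(U ^^ m) y \<in> Ep"
      using LeastI[of "\<lambda>n. (U ^^ n) x \<in> Ep \<and> (U ^^ n) y \<in> Ep" n] that by (auto simp: m_def)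
    moreover have "m \<le> n"
      using that unfolding m_def by (intro Least_le) simp
    ultimately show ?thesis
      using step[of "(U ^^ m) x" "(U ^^ m) y" m "n - m"]
      by (simp add: G_def Un_Un flip: m_def)
  qed
  have D_common: "\<exists>n. (U ^^ n) x \<in> Ep \<and> (U ^^ n) y \<in> Ep \<and> (U ^^ n) z \<in> Ep"
    if "x \<in> D" "y \<in> D" "z \<in> D" for x y z
  proof -
    obtain i j k where "(U ^^ i) x \<in> Ep" "(U ^^ j) y \<in> Ep" "(U ^^ k) z \<in> Ep"
      using \<open>x \<in> D\<close> \<open>y \<in> D\<close> \<open>z \<in> D\<close> by (auto simp: D_def)
    then show ?thesis
      by (intro exI[of _ "i + j + k"] conjI) (auto intro: Un_Ep_mono)
  qed
  have "0 \<in> D" by (auto simp: D_def Ep_mem intro!: exI[of _ 0])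
  have G: "bounded_hermitian_form scaleC ip D G M"
  proof unfold_locales
    show "subspace D"
    proof (rule subspaceI)
      show "x + y \<in> D" if "x \<in> D" "y \<in> D" for x y
        using D_common[OF that \<open>0 \<in> D\<close>] by (auto simp: D_def Un_add intro: Ep_mem)
      show "scaleC c x \<in> D" if "x \<in> D" for c x
        using that by (auto simp: D_def Un_scale intro: Ep_mem)
    qed fact
  next
    fix x y z assume "x \<in> D" "y \<in> D" "z \<in> D"
    then obtain n where n: "(U ^^ n) x \<in> Ep" "(U ^^ n) y \<in> Ep" "(U ^^ n) z \<in> Ep"
      using D_common by blast
    interpret Bn: hankel_form scaleC ip Ep U e "Bs (2 * n)" M by (rule Bs_form)
    have "(U ^^ n) (y + z) \<in> Ep" using n by (simp add: Un_add Ep_mem)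
    then show "G x (y + z) = G x y + G x z"
      using n by (simp add: G_eq Un_add Bn.form_simps)
  next
    fix x y c assume "x \<in> D" "y \<in> D"
    then obtain n where n: "(U ^^ n) x \<in> Ep" "(U ^^ n) y \<in> Ep"
      using D_common[of x y y] by blast
    interpret Bn: hankel_form scaleC ip Ep U e "Bs (2 * n)" M by (rule Bs_form)
    have "(U ^^ n) (scaleC c y) \<in> Ep" using n by (simp add: Un_scale Ep_mem)
    then show "G x (scaleC c y) = c * G x y"
      using n by (simp add: G_eq Un_scale Bn.form_simps)
    show "G y x = cnj (G x y)"
      using n Bn.form_commute[OF n] by (simp add: G_eq)
  next
    fix x assume "x \<in> D"
    then obtain n where n: "(U ^^ n) x \<in> Ep" by (auto simp: D_def)
    interpret Bn: hankel_form scaleC ip Ep U e "Bs (2 * n)" M by (rule Bs_form)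
    show "\<bar>Re (G x x)\<bar> \<le> M * (nm x)\<^sup>2"
      using Bn.form_bound[OF n] n by (simp add: G_eq)
  qed (rule M_nonneg)
  have dense: "htopology ip closure_of D = UNIV"
    unfolding D_def by (rule Union_dense)
  obtain A where A: "\<And>x y. A (x + y) = A x + A y" "\<And>c x. A (scaleC c x) = scaleC c (A x)"
    "\<And>x. nm (A x) \<le> M * nm x" "\<And>x y. ip (A x) y = ip x (A y)"
    "\<And>x y. x \<in> D \<Longrightarrow> y \<in> D \<Longrightarrow> ip x (A y) = G x y"
    by (rule bounded_hermitian_form.operator_of_form[OF G dense]) blast
  have UD: "U x \<in> D" if "x \<in> D" for x
    using that by (auto simp: D_def simp flip: funpow_swap1 intro: U_in_Ep)
  have inv_ip: "ip (inv U x) y = ip x (U y)" "ip y (inv U x) = ip (U y) x" for x y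
    using ip_U_U[of "inv U x" y] ip_U_U[of y "inv U x"] by (simp_all del: ip_U_U)
  have A_U_D: "A (U y) = inv U (A y)" if y: "y \<in> D" for y
  proof (rule dense_ip_eq[OF dense])
    fix x assume x: "x \<in> D"
    obtain n where n: "(U ^^ n) y \<in> Ep" "(U ^^ n) x \<in> Ep"
      using D_common[OF x x y] by blast
    interpret Bn: hankel_form scaleC ip Ep U e "Bs (2 * n)" M by (rule Bs_form)
    have "G (U y) x = G y (U x)"
      using n Bn.hankel G_eq[of n "U y" x] G_eq[of n y "U x"]
      by (simp add: U_in_Ep flip: funpow_swap1)
    then show "ip (A (U y)) x = ip (inv U (A y)) x"
      using x y UD by (simp add: A(4,5) inv_ip)
  qed
  \<comment> \<open>The relation passes from \<open>D\<close> to every \<open>y\<close> by moving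
    the operators across the scalar product onto test vectors in \<open>D\<close>.\<close>
  have A_U: "A (U y) = inv U (A y)" for y
    by (rule dense_ip_eq[OF dense]) (simp add: A(4) inv_ip A_U_D flip: inv_ip(2))
  have "ip x (A y) = B x y" if "x \<in> Ep" "y \<in> Ep" for x y
  proof -
    have "x \<in> D" "y \<in> D" using that by (auto simp: D_def intro!: exI[of _ 0])
    then show ?thesis using that G_eq[of 0 x y] by (simp add: A(5) Bs0)
  qed
  with that[OF A(1-4) A_U] show ?thesis by blast
qed

text \<open>In function space: if a Hankel operator attains its norm, then its minimal symbol has constant modulus.\<close>

lemma Nehari_extension_unimodular:
  assumes f: "f \<in> Ep" "ip e f \<noteq> 0" and eigen: "\<And>x. x \<in> Ep \<Longrightarrow> B x f = of_real M * ip x f"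
  obtains A where "\<And>x y. A (x + y) = A x + A y" "\<And>c x. A (scaleC c x) = scaleC c (A x)"
    "\<And>x y. ip (A x) y = ip x (A y)" "\<And>x. A (U x) = inv U (A x)"
    "\<And>x y. x \<in> Ep \<Longrightarrow> y \<in> Ep \<Longrightarrow> ip x (A y) = B x y"
    "\<And>x. A (A x) = scaleC (of_real (M\<^sup>2)) x"
proof -
  obtain A where A: "\<And>x y. A (x + y) = A x + A y" "\<And>c x. A (scaleC c x) = scaleC c (A x)"
    "\<And>x. nm (A x) \<le> M * nm x" "\<And>x y. ip (A x) y = ip x (A y)" "\<And>x. A (U x) = inv U (A x)"
    "\<And>x y. x \<in> Ep \<Longrightarrow> y \<in> Ep \<Longrightarrow> ip x (A y) = B x y"
    by (rule Nehari_extension) blast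
  \<comment> \<open>Equality case of Cauchy-Schwarz: \<open>ip (A f) f = M (nm f)^2\<close>, while
    \<open>nm (A f)\<close> is at most \<open>M * nm f\<close>.\<close>
  have Af: "A f = scaleC (of_real M) f"
  proof -
    have "ip (A f) f = of_real (M * (nm f)\<^sup>2)"
      using f eigen by (simp add: A(4,6) ip_self)
    then have "(nm (A f - scaleC (of_real M) f))\<^sup>2 = (nm (A f))\<^sup>2 - (M * nm f)\<^sup>2"
      unfolding nm_diff_sq nm_scale by (simp add: ip_simps power2_eq_square power_mult_distrib)
    moreover have "(nm (A f))\<^sup>2 \<le> (M * nm f)\<^sup>2"
      using A(3)[of f] by (simp add: power_mono)
    ultimately have "(nm (A f - scaleC (of_real M) f))\<^sup>2 \<le> 0" by linarith
    then show ?thesis by simp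
  qed
  \<comment> \<open>\<open>A\<close> intertwines \<open>U\<close> with its inverse, so
    \<open>A^2\<close> and hence \<open>L\<close> commute with \<open>U\<close>. Since
    \<open>L f = 0\<close>, \<open>commuting_operator_eq_0\<close> applies.\<close>
  define L where "L x = A (A x) - scaleC (of_real (M\<^sup>2)) x" for x
  have A_inv: "A (inv U x) = U (A x)" for x
    using A(5)[of "inv U x"] by simp
  have "L x = 0" for x
  proof (rule commuting_operator_eq_0[of L _ f])
    show "L (x + y) = L x + L y" for x y
      by (simp add: L_def A(1) scale_right_distrib)
    show "L (scaleC c x) = scaleC c (L x)" for c x
      by (simp add: L_def A(2) scale_right_diff_distrib mult.commute)
    show "nm (L x) \<le> (M\<^sup>2 + M\<^sup>2) * nm x" for x
    proof -
      have "nm (L x) \<le> nm (A (A x)) + nm (scaleC (of_real (M\<^sup>2)) x)"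
        using nm_triangle_sub[of "A (A x)" _ 0] unfolding L_def
        by (metis diff_0_right nm_minus_commute nm_triangle_sub)
      moreover have "nm (A (A x)) \<le> M * (M * nm x)"
        using A(3) M_nonneg by (meson mult_left_mono order_trans)
      moreover have "nm (scaleC (of_real (M\<^sup>2)) x) = M\<^sup>2 * nm x"
        by (simp add: nm_scale norm_power)
      ultimately show ?thesis
        by (simp add: power2_eq_square algebra_simps)
    qed
    show "L (U x) = U (L x)" for x
      by (simp add: L_def A(5) A_inv U_diff U_scale)
    show "L f = 0"
      by (simp add: L_def Af A(2) power2_eq_square)
  qed (use f in auto)
  then have "A (A x) = scaleC (of_real (M\<^sup>2)) x" for x by (simp add: L_def)
  with that[OF A(1,2,4,5,6)] show ?thesis by blast
qed

end

section \<open>Hankel positive operators\<close>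

lemma (in complex_hilbert_space) adjoint_on_eq:
  assumes "subspace V" "z \<in> V" "\<And>x. x \<in> V \<Longrightarrow> ip (A x) y = ip x z"
  shows "adjoint_on ip V A y = z"
  unfolding adjoint_on_def
proof (rule the_equality)
  fix z' assume z': "z' \<in> V \<and> (\<forall>x\<in>V. ip (A x) y = ip x z')"
  then have "z' - z \<in> V" using assms by (simp add: subspace_diff)
  then have "ip (z' - z) z' = ip (z' - z) z" using z' assms(3) by metis
  then have "ip (z' - z) (z' - z) = 0" by (simp add: ip_diff_right)
  then show "z' = z" using ip_definite by force
qed (use assms in auto)

text \<open>Prepares the twist by a scalar \<open>g\<close>. The metric only changes by the factor
  \<open>sqrt c\<close>, so limits and Cauchy sequences stay the same.\<close>

lemma (in complex_hilbert_space) scaled_inner_product: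
  assumes "0 < c" and ip': "ip' = (\<lambda>x y. of_real c * ip x y)"
  shows "complex_hilbert_space scaleC ip'"
    and "closed_subspace scaleC ip' V \<longleftrightarrow> closed_subspace scaleC ip V"
    and "unitary_operator scaleC ip' W \<longleftrightarrow> unitary_operator scaleC ip W"
    and "adjoint_on ip' V W = adjoint_on ip V W"
proof -
  have hdist': "hdist ip' x y = sqrt c * hdist ip x y" for x y
    using \<open>0 < c\<close> by (simp add: ip' hdist_def hnorm_def real_sqrt_mult)
  interpret m': Metric_space UNIV "hdist ip'"
  proof unfold_locales
    show "hdist ip' x z \<le> hdist ip' x y + hdist ip' y z" for x y z
      using \<open>0 < c\<close> hmetric.triangle[of x y z] by (simp add: hdist' flip: distrib_left)
  qed (use \<open>0 < c\<close> in \<open>auto simp: hdist' hmetric.commute\<close>)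
  have lim: "limitin m'.mtopology s z sequentially \<longleftrightarrow> limitin (htopology ip) s z sequentially" for s z
    using \<open>0 < c\<close> tendsto_mult_left_iff[of "sqrt c" "\<lambda>n. hdist ip (s n) z" 0 sequentially]
    by (simp add: m'.limitin_metric_dist_null hmetric.limitin_metric_dist_null hdist')
  have Cauchy: "hmetric.MCauchy s" if "m'.MCauchy s" for s
    unfolding hmetric.MCauchy_def
  proof (intro conjI allI impI)
    fix \<epsilon> :: real assume "\<epsilon> > 0"
    then have "sqrt c * \<epsilon> > 0" using \<open>0 < c\<close> by simp
    then show "\<exists>N. \<forall>n n'. N \<le> n \<longrightarrow> N \<le> n' \<longrightarrow> hdist ip (s n) (s n') < \<epsilon>"
      using that \<open>0 < c\<close> unfolding m'.MCauchy_def hdist' by (metis mult_less_cancel_left_pos real_sqrt_gt_0_iff)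
  qed simp
  have "m'.mcomplete"
    using complete Cauchy by (auto simp: m'.mcomplete_def hmetric.mcomplete_def lim)
  then show "complex_hilbert_space scaleC ip'"
  proof unfold_locales
    show "ip' y x = cnj (ip' x y)" for x y
      using ip_commute[where x=x and y=y] by (simp add: ip')
    show "ip' x x \<in> \<real>\<^sub>\<ge>\<^sub>0" for x
      using \<open>0 < c\<close> by (simp add: ip' ip_self complex_nonneg_Reals_iff)
    show "x = 0" if "ip' x x = 0" for x
      using that \<open>0 < c\<close> ip_definite by (simp add: ip')
  qed (simp_all add: ip' ip_simps distrib_left)
  show "closed_subspace scaleC ip' V \<longleftrightarrow> closed_subspace scaleC ip V"
    by (simp add: closed_subspace_def m'.metric_closedin_iff_sequentially_closed
        hmetric.metric_closedin_iff_sequentially_closed lim)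
  show "unitary_operator scaleC ip' W \<longleftrightarrow> unitary_operator scaleC ip W"
    using \<open>0 < c\<close> by (simp add: unitary_operator_def ip')
  show "adjoint_on ip' V W = adjoint_on ip V W"
    using \<open>0 < c\<close> by (simp add: adjoint_on_def ip' fun_eq_iff)
qed

sublocale hankel_positive_operator \<subseteq> invariant_subspace scaleC ip Ep U
  using U_unitary Ep_closed_subspace U_Ep by unfold_locales auto

context hankel_positive_operator
begin

lemma H_in_Ep: "x \<in> Ep \<Longrightarrow> H x \<in> Ep"
  and H_add: "x \<in> Ep \<Longrightarrow> y \<in> Ep \<Longrightarrow> H (x + y) = H x + H y"
  and H_scale: "x \<in> Ep \<Longrightarrow> H (scaleC c x) = scaleC c (H x)"
  and H_nonneg: "x \<in> Ep \<Longrightarrow> ip x (H x) \<in> \<real>\<^sub>\<ge>\<^sub>0"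
  using H_positive by (auto simp: positive_operator_on_def bounded_operator_on_def)

lemma H_bounded: obtains C where "0 \<le> C" "\<And>x. x \<in> Ep \<Longrightarrow> nm (H x) \<le> C * nm x"
proof -
  obtain C where C: "\<And>x. x \<in> Ep \<Longrightarrow> nm (H x) \<le> C * nm x"
    using H_positive unfolding positive_operator_on_def bounded_operator_on_def by blast
  have "nm (H x) \<le> max C 0 * nm x" if "x \<in> Ep" for x
    using C[OF that] mult_right_mono[of C "max C 0" "nm x"] by simp
  then show ?thesis using that[of "max C 0"] by simp
qed

text \<open>Positivity makes the diagonal values real; polarization with \<open>x + y\<close> and
  \<open>x + i y\<close> then gives symmetry.\<close>

lemma H_symmetric:
  assumes "x \<in> Ep" "y \<in> Ep"
  shows "ip y (H x) = cnj (ip x (H y))"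
proof -
  have real: "Im (ip v (H v)) = 0" if "v \<in> Ep" for v
    using H_nonneg[OF that] by (simp add: complex_nonneg_Reals_iff)
  have "scaleC \<i> y \<in> Ep" using assms by (simp add: Ep_mem)
  have "Im (ip y (H x)) = - Im (ip x (H y))"
    using real[of "x + y"] real[of x] real[of y] assms by (simp add: Ep_mem H_add ip_simps)
  moreover have "Re (ip y (H x)) = Re (ip x (H y))"
    using real[of "x + scaleC \<i> y"] real[of x] real[of y] assms \<open>scaleC \<i> y \<in> Ep\<close>
    by (simp add: Ep_mem H_add H_scale ip_simps)
  ultimately show ?thesis by (simp add: complex_eq_iff)
qed

text \<open>Since \<open>adjoint_on\<close> is a definite description, its value must be produced
  before the Hankel relation can be unfolded: Riesz gives the vector, and closedness keeps it in
  \<open>Ep\<close>.\<close>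

lemma H_hankel_form:
  assumes "x \<in> Ep" "y \<in> Ep"
  shows "ip (U x) (H y) = ip x (H (U y))"
proof -
  have sub: "subspace Ep" using Ep_closed_subspace by (simp add: closed_subspace_iff)
  obtain s z where s: "range s \<subseteq> Ep" "converges s z" and z: "\<And>x. x \<in> Ep \<Longrightarrow> ip (H y) (U x) = ip z x"
    by (rule Riesz_on_subspace[OF sub, of "\<lambda>x. ip (H y) (U x)" "nm (H y)"])
      (use Cauchy_Schwarz[of "H y" "U _"] in \<open>auto simp: U_add U_scale ip_simps\<close>)
  have "z \<in> Ep" using s(1) by (intro Ep_limit[OF _ s(2)]) auto
  moreover have "ip (U x) (H y) = ip x z" if "x \<in> Ep" for x
    using z[OF that] by (metis ip_commute)
  ultimately have "H (U y) = z"
    using H_hankel[OF \<open>y \<in> Ep\<close>] adjoint_on_eq[OF sub, of z U "H y"] by simp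
  then show ?thesis using \<open>\<And>x. x \<in> Ep \<Longrightarrow> ip (U x) (H y) = ip x z\<close> assms by simp
qed

text \<open>The solution \<open>y\<close> is the tail of the eigenvector \<open>e + U y\<close>
  sought for the extended form. As \<open>U\<close> is isometric, dividing the left side by
  \<open>M\<close> gives a contraction of \<open>Ep\<close> with constant
  \<open>C / M\<close>.\<close>

lemma H_fixed_point:
  assumes C: "0 \<le> C" "\<And>x. x \<in> Ep \<Longrightarrow> nm (H x) \<le> C * nm x" and "C < M" and "e \<in> Ep"
  obtains y where "y \<in> Ep" "H (e + U y) = scaleC (of_real M) y"
proof -
  have "0 < M" using C(1) \<open>C < M\<close> by simp
  define T where "T y = scaleC (1 / of_real M) (H (e + U y))" for y
  have T_Ep: "T y \<in> Ep" if "y \<in> Ep" for y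
    using that \<open>e \<in> Ep\<close> by (simp add: T_def Ep_mem H_in_Ep U_in_Ep)
  interpret S: Submetric UNIV "hdist ip" Ep by unfold_locales simp
  have compl: "S.sub.mcomplete"
    using S.closedin_mcomplete_imp_mcomplete Ep_closed_subspace complete
    by (simp add: closed_subspace_def)
  have con: "hdist ip (T x) (T y) \<le> C / M * hdist ip x y" if "x \<in> Ep" "y \<in> Ep" for x y
  proof -
    have "T x - T y = scaleC (1 / of_real M) (H (U (x - y)))"
    proof -
      have "H (e + U x) = H ((e + U y) + U (x - y))" by (simp add: U_diff)
      also have "\<dots> = H (e + U y) + H (U (x - y))"
        using that \<open>e \<in> Ep\<close> by (intro H_add) (auto intro!: Ep_mem U_in_Ep)
      finally show ?thesis by (simp add: T_def scale_right_distrib)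
    qed
    moreover have "nm (H (U (x - y))) \<le> C * nm (x - y)"
      using C(2)[of "U (x - y)"] that by (simp add: Ep_mem U_in_Ep)
    ultimately show ?thesis
      using \<open>0 < M\<close> by (simp add: hdist_def nm_scale norm_divide divide_right_mono)
  qed
  obtain y where y: "y \<in> Ep" "T y = y"
  proof (rule S.sub.Banach_fixedpoint_thm[OF compl _ _ _ con])
    show "Ep \<noteq> {}" using \<open>e \<in> Ep\<close> by auto
    show "T \<in> Ep \<rightarrow> Ep" using T_Ep by auto
    show "C / M < 1" using \<open>0 < M\<close> \<open>C < M\<close> by simp
  qed
  have "scaleC (of_real M) (T y) = H (e + U y)"
    using \<open>0 < M\<close> by (simp add: T_def)
  then show ?thesis using that y by simp
qed

end

text \<open>\<open>e\<close> is the vector with \<open>\<phi> e = 1\<close>. The decomposition comes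
  from projecting onto \<open>U Ep\<close>, whose complement in \<open>Ep\<close> is the line
  through \<open>e\<close>.\<close>

lemma (in regular_multiplicity_free_hankel_positive_operator) wandering_vector:
  obtains e where "simple_shift scaleC ip Ep U e"
proof -
  let ?K = "wandering_subspace ip Ep U"
  obtain \<phi> :: "'a \<Rightarrow> complex" where \<phi>: "bij_betw \<phi> ?K UNIV"
    "\<And>x y. x \<in> ?K \<Longrightarrow> y \<in> ?K \<Longrightarrow> ip x y = cnj (\<phi> x) * \<phi> y"
    "\<And>c x. x \<in> ?K \<Longrightarrow> \<phi> (scaleC c x) = c * \<phi> x"
    using multiplicity_free by blast
  obtain e where e: "e \<in> ?K" "\<phi> e = 1"
    using \<phi>(1) by (metis bij_betw_imp_surj_on UNIV_I imageE)
  have K_iff: "x \<in> ?K \<longleftrightarrow> x \<in> Ep \<and> (\<forall>y\<in>Ep. ip (U y) x = 0)" for x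
    by (auto simp: wandering_subspace_def orth_compl_def)
  have K_eq: "x = scaleC (\<phi> x) e" if "x \<in> ?K" for x
  proof -
    have "scaleC (\<phi> x) e \<in> ?K" using e(1) by (simp add: K_iff Ep_mem ip_scale_right)
    moreover have "\<phi> (scaleC (\<phi> x) e) = \<phi> x" using e by (simp add: \<phi>(3))
    ultimately show ?thesis
      using \<phi>(1) that by (metis bij_betw_imp_inj_on inj_onD)
  qed
  have sub: "subspace (U ` Ep)"
  proof (rule subspaceI)
    show "0 \<in> U ` Ep" using Ep_mem(1) by (metis U_zero imageI)
    show "x + y \<in> U ` Ep" if "x \<in> U ` Ep" "y \<in> U ` Ep" for x y
      using that by (auto simp: Ep_mem simp flip: U_add)
    show "scaleC c x \<in> U ` Ep" if "x \<in> U ` Ep" for c x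
      using that by (auto simp: Ep_mem simp flip: U_scale)
  qed
  have "e \<in> Ep" using e(1) by (simp add: K_iff)
  have ip_e_U: "ip e (U y) = 0" if "y \<in> Ep" for y
    using e(1) that by (metis K_iff ip_commute complex_cnj_zero)
  have "ip e e = 1" using \<phi>(2)[OF e(1) e(1)] e(2) by simp
  have decomp: "\<exists>z\<in>Ep. x = scaleC (ip e x) e + U z" if x: "x \<in> Ep" for x
  proof -
    \<comment> \<open>\<open>p\<close> is the projection of \<open>x\<close> to \<open>U Ep\<close>.
      It stays in \<open>U Ep\<close> because the preimages of the \<open>s n\<close> under
      \<open>U\<close> converge in the closed space \<open>Ep\<close>.\<close>
    obtain s p where s: "range s \<subseteq> U ` Ep" "converges s p" and p: "\<And>v. v \<in> U ` Ep \<Longrightarrow> ip x v = ip p v"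
      by (rule Riesz_on_subspace[OF sub, of "ip x" "nm x"]) (auto simp: ip_simps Cauchy_Schwarz)
    have "converges (\<lambda>n. inv U (s n)) (inv U p)"
      using s(2) by (rule converges_isometric[of _ _ _ _ 1]) (metis inv_U_diff U_inv nm_U mult_1 order_refl)
    moreover have "inv U (s n) \<in> Ep" for n
    proof -
      obtain t where "t \<in> Ep" "s n = U t" using s(1) by blast
      then show ?thesis by simp
    qed
    ultimately have z: "inv U p \<in> Ep" using Ep_limit by meson
    have "x - p \<in> ?K"
      using x U_in_Ep[OF z] p by (auto simp: K_iff Ep_mem ip_diff_right) (metis imageI ip_commute)
    then have eq: "x = scaleC (\<phi> (x - p)) e + U (inv U p)"
      using K_eq by (metis U_inv diff_add_cancel)
    then have "ip e x = \<phi> (x - p)"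
      using ip_e_U[OF z] \<open>ip e e = 1\<close> by (metis ip_add_right ip_scale_right add_0_right mult_1_right)
    then show ?thesis using eq z by metis
  qed
  have Inter: "x = 0" if "\<And>n. x \<in> (U ^^ n) ` Ep" for x
  proof -
    have "x \<in> int_funpow U n ` Ep" for n
    proof (cases "0 \<le> n")
      case False
      have "x \<in> Ep" using that[of 0] by simp
      then have "(U ^^ nat (- n)) x \<in> Ep" by (rule Un_Ep)
      then have "(inv U ^^ nat (- n)) ((U ^^ nat (- n)) x) \<in> (inv U ^^ nat (- n)) ` Ep"
        by (rule imageI)
      then show ?thesis using False by (simp add: int_funpow_def inv_Un)
    qed (simp add: int_funpow_def that)
    then show ?thesis using regular_Inter by blast
  qed
  have "(\<Union>n. int_funpow U n ` Ep) \<subseteq> {x. \<exists>n. (U ^^ n) x \<in> Ep}"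
  proof clarify
    fix n x assume "x \<in> Ep"
    then show "\<exists>k. (U ^^ k) (int_funpow U n x) \<in> Ep"
      by (cases "0 \<le> n") (auto simp: int_funpow_def Un_inv intro: exI[of _ 0] exI[of _ "nat (- n)"] Un_Ep)
  qed
  then have "htopology ip closure_of {x. \<exists>n. (U ^^ n) x \<in> Ep} = UNIV"
    using closure_of_mono[of _ _ "htopology ip"] regular_Union by (metis top.extremum_uniqueI)
  with \<open>e \<in> Ep\<close> \<open>ip e e = 1\<close> ip_e_U decomp Inter have "simple_shift scaleC ip Ep U e"
    by unfold_locales auto
  then show ?thesis by (rule that)
qed

theorem theorem4p8:
  fixes scaleC :: "complex \<Rightarrow> 'a::ab_group_add \<Rightarrow> 'a"
    and ip :: "'a \<Rightarrow> 'a \<Rightarrow> complex"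
    and Ep :: "'a set" and U H :: "'a \<Rightarrow> 'a"
  assumes "regular_multiplicity_free_hankel_positive_operator scaleC ip Ep U H"
  shows "\<exists>g \<theta>.
    g \<in> GL scaleC ip \<and> g ` Ep = Ep \<and> g \<circ> U = U \<circ> g \<and>
    \<theta> \<in> GL scaleC ip \<and> unitary_operator scaleC ip \<theta> \<and> \<theta> \<circ> \<theta> = id \<and>
    \<theta> \<circ> U \<circ> \<theta> = adjoint_on ip UNIV U \<and>
    unitary_operator scaleC (ip_twist ip g) \<theta> \<and>
    reflection_positive_operator scaleC (ip_twist ip g) Ep \<theta> U \<and>
    (\<forall>\<xi>\<in>Ep. \<forall>\<eta>\<in>Ep. ip \<xi> (H \<eta>) = ip_twist ip g \<xi> (\<theta> \<eta>))"
proof -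
  interpret regular_multiplicity_free_hankel_positive_operator scaleC ip Ep U H by fact
  obtain e where "simple_shift scaleC ip Ep U e" by (rule wandering_vector)
  then interpret simple_shift scaleC ip Ep U e .
  obtain C where C: "0 \<le> C" "\<And>x. x \<in> Ep \<Longrightarrow> nm (H x) \<le> C * nm x"
    by (rule H_bounded) blast
  \<comment> \<open>A number strictly above \<open>C\<close> makes the fixed-point map a
    contraction; being positive, it can also be divided by.\<close>
  define M where "M = C + 1"
  have "0 < M" "C < M" using C(1) by (simp_all add: M_def)
  interpret B: hankel_form scaleC ip Ep U e "\<lambda>x y. ip x (H y)" M
  proof unfold_locales
    show "subspace Ep" using closed_Ep by (simp add: closed_subspace_iff)
    show "\<bar>Re (ip x (H x))\<bar> \<le> M * (nm x)\<^sup>2" if x: "x \<in> Ep" for x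
    proof -
      have "\<bar>Re (ip x (H x))\<bar> \<le> nm x * nm (H x)" by (rule Re_ip_le)
      also have "\<dots> \<le> nm x * (M * nm x)"
        using C(2)[OF x] mult_right_mono[of C M "nm x"] \<open>C < M\<close>
        by (intro mult_left_mono) auto
      finally show ?thesis by (simp add: power2_eq_square mult_ac)
    qed
  qed (use \<open>0 < M\<close> in \<open>auto simp: ip_simps H_add H_scale H_hankel_form intro: H_symmetric\<close>)
  obtain y where y: "y \<in> Ep" "H (e + U y) = scaleC (of_real M) y"
    using H_fixed_point[OF C \<open>C < M\<close> e_in_Ep] by blast
  have eq: "ip v (H (e + U y)) = of_real M * ip v y" for v
    by (simp add: y ip_scale_right)
  \<comment> \<open>The maximal admissible coefficient \<open>a_(-1)\<close>; for it
    \<open>e + U y\<close> is an eigenvector of the extended form with eigenvalue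
    \<open>M\<close>.\<close>
  let ?t = "B.upper y"
  interpret E: hankel_form scaleC ip Ep U e "B.extension ?t" M
    by (rule B.extremal_extension(1)[OF y(1) eq])
  have f: "e + U y \<in> Ep" "ip e (e + U y) \<noteq> 0"
    using y by (auto simp: Ep_mem e_in_Ep U_in_Ep ip_simps ip_e_e ip_e_U)
  obtain A where A: "\<And>x y. A (x + y) = A x + A y" "\<And>c x. A (scaleC c x) = scaleC c (A x)"
    "\<And>x y. ip (A x) y = ip x (A y)" "\<And>x. A (U x) = inv U (A x)"
    "\<And>x y. x \<in> Ep \<Longrightarrow> y \<in> Ep \<Longrightarrow> ip x (A y) = B.extension ?t x y"
    "\<And>x. A (A x) = scaleC (of_real (M\<^sup>2)) x"
    by (rule E.Nehari_extension_unimodular[OF f B.extremal_extension(2)[OF y(1) eq]]) (assumption, rule that)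
  \<comment> \<open>\<open>A\<close> has the matrix \<open>a_(j+k-1)\<close>, and composing with
    \<open>U\<close> restores \<open>a_(j+k)\<close>. The relations \<open>A U = U^-1 A\<close> and
    \<open>A^2 = M^2\<close> make \<open>\<theta>\<close> an involution.\<close>
  define \<theta> where "\<theta> x = scaleC (1 / of_real M) (A (U x))" for x
  \<comment> \<open>The twisted product is then \<open>M\<close> times the original one, which
    compensates the division by \<open>M\<close> in \<open>\<theta>\<close>.\<close>
  define g where "g = scaleC (of_real (sqrt M))"
  have AU_AU: "A (U (A (U x))) = scaleC (of_real (M\<^sup>2)) x" for x
    by (simp add: A(4,6))
  have \<theta>\<theta>: "\<theta> (\<theta> x) = x" for x
    using \<open>0 < M\<close> by (simp add: \<theta>_def U_scale A(2) AU_AU power2_eq_square)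
  have \<theta>_lin: "\<theta> (x + y) = \<theta> x + \<theta> y" "\<theta> (scaleC c x) = scaleC c (\<theta> x)" for c x y
    by (simp_all add: \<theta>_def U_add U_scale A(1,2) scale_right_distrib mult.commute)
  have \<theta>_ip: "ip (\<theta> x) (\<theta> y) = ip x y" for x y
    using \<open>0 < M\<close> by (simp add: \<theta>_def ip_simps A(3) A(6) power2_eq_square)
  have \<theta>_inv: "\<theta> \<circ> \<theta> = id" by (simp add: fun_eq_iff \<theta>\<theta>)
  have bij_\<theta>: "bij \<theta>" and inv_\<theta>: "inv \<theta> = \<theta>"
    using o_bij[OF \<theta>_inv \<theta>_inv] inv_unique_comp[OF \<theta>_inv \<theta>_inv] by simp_all
  have \<theta>_unitary: "unitary_operator scaleC ip \<theta>"
    using bij_\<theta> by (simp add: unitary_operator_iff \<theta>_lin \<theta>_ip bij_is_surj)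
  have "bounded_operator_on scaleC ip UNIV \<theta>"
    by (auto simp: bounded_operator_on_def \<theta>_lin hnorm_def \<theta>_ip intro!: exI[of _ 1])
  then have \<theta>_GL: "\<theta> \<in> GL scaleC ip" by (simp add: GL_def bij_\<theta> inv_\<theta>)
  have \<theta>_U: "\<theta> (U (\<theta> x)) = inv U x" for x
  proof -
    have "\<theta> (U (\<theta> x)) = inv U (\<theta> (\<theta> x))"
      by (simp add: \<theta>_def A(4) inv_U_scale)
    then show ?thesis by (simp add: \<theta>\<theta>)
  qed
  have "adjoint_on ip UNIV U x = inv U x" for x
    using ip_U_U[of _ "inv U x"] by (intro adjoint_on_eq) (simp_all del: ip_U_U)
  then have \<theta>_adj: "\<theta> \<circ> U \<circ> \<theta> = adjoint_on ip UNIV U" by (simp add: fun_eq_iff \<theta>_U)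
  have bounded_scale: "bounded_operator_on scaleC ip UNIV (scaleC c)" for c
    by (auto simp: bounded_operator_on_def scale_right_distrib nm_scale mult.commute)
  have inv_g: "scaleC (of_real (1 / sqrt M)) (g x) = x" "g (scaleC (of_real (1 / sqrt M)) x) = x" for x
    using \<open>0 < M\<close> by (simp_all add: g_def)
  then have "scaleC (of_real (1 / sqrt M)) \<circ> g = id" "g \<circ> scaleC (of_real (1 / sqrt M)) = id"
    by (simp_all only: fun_eq_iff o_apply id_apply simp_thms)
  then have "bij g" and "inv g = scaleC (of_real (1 / sqrt M))"
    using o_bij inv_unique_comp by blast+
  then have g_GL: "g \<in> GL scaleC ip"
    using bounded_scale by (auto simp: GL_def g_def)
  have g_Ep: "g ` Ep = Ep"
  proof
    show "g ` Ep \<subseteq> Ep" by (auto simp: g_def Ep_mem)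
    show "Ep \<subseteq> g ` Ep" using inv_g(2) Ep_mem(4) by (metis image_eqI subsetI)
  qed
  have twist: "ip_twist ip g = (\<lambda>x y. of_real M * ip x y)"
    using \<open>0 < M\<close> by (simp add: fun_eq_iff ip_twist_def g_def ip_simps flip: mult.assoc of_real_mult)
  note scaled = scaled_inner_product[OF \<open>0 < M\<close> twist]
  have form: "ip \<xi> (H \<eta>) = ip_twist ip g \<xi> (\<theta> \<eta>)" if "\<xi> \<in> Ep" "\<eta> \<in> Ep" for \<xi> \<eta>
    using that \<open>0 < M\<close> A(5)[of \<xi> "U \<eta>"] B.extension_U(1)[of \<xi> \<eta>]
    by (simp add: twist \<theta>_def ip_scale_right U_in_Ep)
  interpret T: complex_hilbert_space scaleC "ip_twist ip g" by (rule scaled(1))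
  have "reflection_positive_operator scaleC (ip_twist ip g) Ep \<theta> U"
  proof unfold_locales
    show "ip_twist ip g \<xi> (\<theta> \<xi>) \<in> \<real>\<^sub>\<ge>\<^sub>0" if "\<xi> \<in> Ep" for \<xi>
      using H_nonneg[OF that] form[OF that that] by simp
  qed (use \<theta>_unitary \<theta>_inv Ep_closed_subspace U_unitary U_Ep \<theta>_adj in \<open>auto simp: scaled\<close>)
  moreover have "g \<circ> U = U \<circ> g" by (simp add: fun_eq_iff g_def U_scale)
  moreover have "unitary_operator scaleC (ip_twist ip g) \<theta>" using \<theta>_unitary by (simp add: scaled)
  ultimately show ?thesis
    using g_GL g_Ep \<theta>_GL \<theta>_unitary \<theta>_inv \<theta>_adj form by blast
qed

end
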